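(* Let $T = \{(x,y)\in\mathbb{R}^2 : 0 \leq x \leq 1,\ 0 \leq y \leq 1-x\}$ be the right isosceles triangle. Consider the Dirichlet eigenfunction problem $$-h^2\Delta u = u \text{ on } T,\qquad u|_{\partial T} = 0,\qquad \|u\|_{L^2(T)} = 1,$$ where $\Delta = \partial_x^2+\partial_y^2$ and $h^{-2}$ (with $h>0$) ranges over the discrete set of Dirichlet eigenvalues of $-\Delta$ on $T$. Then there is an orthonormal basis of $L^2(T)$ consisting of eigenfunctions $u$ (each solving the problem above with its own $h$) all of which satisfy $$\|h\partial_x u\|_{L^2(T)}^2 = \|h\partial_y u\|_{L^2(T)}^2 = \frac12 .$$ On the other hand, there exists a subsequence of these basis eigenfunctions, along which $h\to 0$, whose Neumann data satisfies $$\liminf_{h\to 0}\int_{0}^{1/2} |h\partial_\nu u(x,0)|^2\,dx \;>\; \limsup_{h\to 0}\int_{1/2}^{1} |h\partial_\nu u(x,0)|^2\,dx ,$$ where the liminf and limsup are taken along the subsequence.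
   Context: $\partial_\nu$ denotes the outward unit normal derivative on $\partial T$; on the bottom side $\{y=0\}$ it equals $-\partial_y$. For each eigenfunction $u$, $h>0$ denotes the number such that $h^{-2}$ is the corresponding eigenvalue of $-\Delta$. *)

theory Defs
  imports "HOL-Analysis.Analysis"
begin

subsection \<open>Square-integrable functions on a set\<close>

definition L2 :: "'a::euclidean_space set \<Rightarrow> ('a \<Rightarrow> real) set" where
  "L2 S = {f. f \<in> borel_measurable (lebesgue_on S) \<and> integrable (lebesgue_on S) (\<lambda>p. (f p)\<^sup>2)}"

definition L2_inner :: "'a::euclidean_space set \<Rightarrow> ('a \<Rightarrow> real) \<Rightarrow> ('a \<Rightarrow> real) \<Rightarrow> real" where
  "L2_inner S f g = (LINT p|lebesgue_on S. f p * g p)"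

definition L2_norm :: "'a::euclidean_space set \<Rightarrow> ('a \<Rightarrow> real) \<Rightarrow> real" where
  "L2_norm S f = sqrt (LINT p|lebesgue_on S. (f p)\<^sup>2)"

definition orthonormal_basis_L2 :: "'a::euclidean_space set \<Rightarrow> (nat \<Rightarrow> 'a \<Rightarrow> real) \<Rightarrow> bool" where
  "orthonormal_basis_L2 S u \<longleftrightarrow>
     (\<forall>n. u n \<in> L2 S) \<and>
     (\<forall>m n. L2_inner S (u m) (u n) = (if m = n then 1 else 0)) \<and>
     (\<forall>f\<in>L2 S. (\<lambda>N. L2_norm S (\<lambda>p. f p - (\<Sum>n<N. L2_inner S f (u n) * u n p))) \<longlonglongrightarrow> 0)"

subsection \<open>The triangle and its Dirichlet eigenfunctions\<close>

definition T :: "(real \<times> real) set" where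
  "T = {(x, y). 0 \<le> x \<and> x \<le> 1 \<and> 0 \<le> y \<and> y \<le> 1 - x}"

text \<open>
  Derivatives are taken within the closed triangle: they are the ordinary ones in the interior and
  one-sided ones on the boundary. Since \<open>T\<close> is convex with nonempty interior, the derivative
  within \<open>T\<close> of a differentiable function is unique at every point of \<open>T\<close>, vertices included.
\<close>

definition dir_deriv :: "real \<times> real \<Rightarrow> (real \<times> real \<Rightarrow> real) \<Rightarrow> real \<times> real \<Rightarrow> real" where
  "dir_deriv v u p = frechet_derivative u (at p within T) v"

abbreviation dx :: "(real \<times> real \<Rightarrow> real) \<Rightarrow> real \<times> real \<Rightarrow> real" where
  "dx \<equiv> dir_deriv (1, 0)"

abbreviation dy :: "(real \<times> real \<Rightarrow> real) \<Rightarrow> real \<times> real \<Rightarrow> real" where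
  "dy \<equiv> dir_deriv (0, 1)"

definition laplacian :: "(real \<times> real \<Rightarrow> real) \<Rightarrow> real \<times> real \<Rightarrow> real" where
  "laplacian u p = dx (dx u) p + dy (dy u) p"

definition C2_on_T :: "(real \<times> real \<Rightarrow> real) \<Rightarrow> bool" where
  "C2_on_T u \<longleftrightarrow>
     u differentiable_on T \<and> dx u differentiable_on T \<and> dy u differentiable_on T \<and>
     continuous_on T (dx (dx u)) \<and> continuous_on T (dy (dx u)) \<and>
     continuous_on T (dx (dy u)) \<and> continuous_on T (dy (dy u))"

text \<open>
  Every Dirichlet eigenfunction of this triangle is a trigonometric polynomial, so asking for two
  continuous derivatives up to the boundary excludes none of them.
\<close>

definition dirichlet_eigenfunction :: "real \<Rightarrow> (real \<times> real \<Rightarrow> real) \<Rightarrow> bool" where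
  "dirichlet_eigenfunction h u \<longleftrightarrow>
     h > 0 \<and> C2_on_T u \<and>
     (\<forall>p\<in>T. - (h\<^sup>2) * laplacian u p = u p) \<and>
     (\<forall>p\<in>frontier T. u p = 0) \<and>
     L2_norm T u = 1"

text \<open>The values of the outward unit normal at the three vertices are immaterial.\<close>

definition outward_normal :: "real \<times> real \<Rightarrow> real \<times> real" where
  "outward_normal p =
     (if snd p = 0 then (0, -1) else if fst p = 0 then (-1, 0) else (1 / sqrt 2, 1 / sqrt 2))"

definition normal_deriv :: "(real \<times> real \<Rightarrow> real) \<Rightarrow> real \<times> real \<Rightarrow> real" where
  "normal_deriv u p = dir_deriv (outward_normal p) u p"

end

theory Submission
  imports Defs "HOL-Real_Asymp.Real_Asymp"
begin

text \<open>
  The eigenfunctions are the Dirichlet modes of the unit square that are odd under the reflection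
  \<open>(x, y) \<mapsto> (1 - y, 1 - x)\<close> in the hypotenuse, namely
  \<open>2 (sin m\<pi>x sin n\<pi>y - (-1)\<^bsup>m+n\<^esup> sin n\<pi>x sin m\<pi>y)\<close> with \<open>m > n > 0\<close>. Their inner products reduce by this
  reflection to integrals over the square, and the symmetry under \<open>(x, y) \<mapsto> (y, x)\<close> balances the two
  partial derivatives.

  For completeness, the continuous functions that multiply the span of the modes into itself form
  an algebra. It contains \<open>cos \<pi>x - cos \<pi>y\<close> and \<open>cos \<pi>x cos \<pi>y\<close>, which separate the points of the
  triangle, so by Stone--Weierstrass it is dense in the continuous functions. Hence the closed
  span contains \<open>g w\<close> for all continuous \<open>g\<close>, where \<open>w\<close> is the ground state, and as \<open>w\<close> is positive in
  the interior these products are dense in \<open>L2\<close>.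

  For \<open>m = n + 1\<close> the cross term of the two sines has a nonvanishing integral over each half of the
  bottom side, with opposite signs, and the Neumann masses tend to \<open>1 + 2/\<pi>\<close> and \<open>1 - 2/\<pi>\<close>.
\<close>

subsection \<open>Orthonormal systems in \<open>L2\<close>\<close>

lemma L2_mult_integrable:
  assumes "f \<in> L2 S" "g \<in> L2 S"
  shows "integrable (lebesgue_on S) (\<lambda>p. f p * g p)"
proof (rule Bochner_Integration.integrable_bound)
  show "integrable (lebesgue_on S) (\<lambda>p. (f p)\<^sup>2 + (g p)\<^sup>2)"
    using assms by (auto simp: L2_def)
  show "(\<lambda>p. f p * g p) \<in> borel_measurable (lebesgue_on S)"
    using assms by (auto simp: L2_def)
  have "\<bar>a * b\<bar> \<le> a\<^sup>2 + b\<^sup>2" for a b :: real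
  proof -
    have "2 * \<bar>a\<bar> * \<bar>b\<bar> \<le> a\<^sup>2 + b\<^sup>2" 
      using sum_squares_bound[of "\<bar>a\<bar>" "\<bar>b\<bar>"] by simp
    moreover have "0 \<le> \<bar>a\<bar> * \<bar>b\<bar>" by simp
    ultimately show ?thesis unfolding abs_mult by linarith
  qed
  then show "AE p in lebesgue_on S. norm (f p * g p) \<le> norm ((f p)\<^sup>2 + (g p)\<^sup>2)"
    by (intro AE_I2) (auto simp: abs_mult)
qed

lemma L2_add:
  assumes "f \<in> L2 S" "g \<in> L2 S"
  shows "(\<lambda>p. f p + g p) \<in> L2 S"
proof -
  have "integrable (lebesgue_on S) (\<lambda>p. (f p)\<^sup>2 + (g p)\<^sup>2 + 2 * (f p * g p))"
    using assms L2_mult_integrable[OF assms] by (auto simp: L2_def)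
  then show ?thesis
    using assms by (auto simp: L2_def power2_sum algebra_simps)
qed

lemma L2_cmult: "f \<in> L2 S \<Longrightarrow> (\<lambda>p. c * f p) \<in> L2 S"
  by (auto simp: L2_def power_mult_distrib)

lemma L2_diff:
  assumes "f \<in> L2 S" "g \<in> L2 S"
  shows "(\<lambda>p. f p - g p) \<in> L2 S"
  using L2_add[OF assms(1) L2_cmult[OF assms(2), of "-1"]] by simp

lemma L2_sum:
  assumes "\<And>i. i \<in> I \<Longrightarrow> f i \<in> L2 S"
  shows "(\<lambda>p. \<Sum>i\<in>I. f i p) \<in> L2 S"
  using assms
proof (induction I rule: infinite_finite_induct)
  case (insert i I)
  then show ?case using L2_add[of "f i" S "\<lambda>p. \<Sum>i\<in>I. f i p"] by simp
qed (auto simp: L2_def)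

lemma L2_norm_power2: "(L2_norm S f)\<^sup>2 = L2_inner S f f"
  by (simp add: L2_norm_def L2_inner_def power2_eq_square[symmetric])

lemma L2_norm_nonneg: "0 \<le> L2_norm S f"
  by (simp add: L2_norm_def)

lemma L2_norm_triangle_sq:
  assumes "f \<in> L2 S" "g \<in> L2 S"
  shows "(L2_norm S (\<lambda>p. f p + g p))\<^sup>2 \<le> 2 * (L2_norm S f)\<^sup>2 + 2 * (L2_norm S g)\<^sup>2"
proof -
  have "(L2_norm S (\<lambda>p. f p + g p))\<^sup>2 = (LINT p|lebesgue_on S. (f p + g p)\<^sup>2)"
    by (simp add: L2_norm_def)
  also have "\<dots> \<le> (LINT p|lebesgue_on S. 2 * (f p)\<^sup>2 + 2 * (g p)\<^sup>2)"
  proof (rule integral_mono)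
    show "integrable (lebesgue_on S) (\<lambda>p. (f p + g p)\<^sup>2)"
      using L2_add[OF assms] by (simp add: L2_def)
    show "integrable (lebesgue_on S) (\<lambda>p. 2 * (f p)\<^sup>2 + 2 * (g p)\<^sup>2)"
      using assms by (auto simp: L2_def)
    show "(f p + g p)\<^sup>2 \<le> 2 * (f p)\<^sup>2 + 2 * (g p)\<^sup>2" for p
      using sum_squares_bound[of "f p" "g p"] by (simp add: power2_sum)
  qed
  also have "\<dots> = 2 * (L2_norm S f)\<^sup>2 + 2 * (L2_norm S g)\<^sup>2"
    using assms by (simp add: L2_norm_def L2_def)
  finally show ?thesis .
qed

text \<open>Adding the term with coefficient \<open>c N\<close> changes the squared distance by a
  quadratic in \<open>c N\<close>, and completing the square gives the summand. Arbitrary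
  coefficients are allowed so that any combination can be compared with the Fourier partial sum, for
  which the first square vanishes.\<close>

lemma L2_norm_diff_sum_sq:
  fixes u :: "nat \<Rightarrow> 'a::euclidean_space \<Rightarrow> real"
  assumes u: "\<And>n. u n \<in> L2 S"
    and orth: "\<And>m n. L2_inner S (u m) (u n) = (if m = n then 1 else 0)"
    and f: "f \<in> L2 S"
  shows "(L2_norm S (\<lambda>p. f p - (\<Sum>n<N. c n * u n p)))\<^sup>2 =
    L2_inner S f f + (\<Sum>n<N. (c n - L2_inner S f (u n))\<^sup>2 - (L2_inner S f (u n))\<^sup>2)"
proof (induction N)
  case 0
  then show ?case by (simp add: L2_norm_power2)
next
  case (Suc N)
  let ?g = "\<lambda>p. f p - (\<Sum>n<N. c n * u n p)"
  have g: "?g \<in> L2 S"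
    by (intro L2_diff L2_sum L2_cmult u f)
  \<comment> \<open>The terms already subtracted are orthogonal to \<open>u N\<close>, so the
    remainder has the same coefficient as \<open>f\<close>.\<close>
  have "L2_inner S ?g (u N) = L2_inner S f (u N) - (\<Sum>n<N. c n * L2_inner S (u n) (u N))"
    unfolding L2_inner_def
    using L2_mult_integrable[OF f u] L2_mult_integrable[OF u u]
    by (simp add: left_diff_distrib sum_distrib_right mult.assoc)
  also have "\<dots> = L2_inner S f (u N)"
    by (simp add: orth)
  finally have gN: "L2_inner S ?g (u N) = L2_inner S f (u N)" .
  have "(L2_norm S (\<lambda>p. f p - (\<Sum>n<Suc N. c n * u n p)))\<^sup>2 =
      (LINT p|lebesgue_on S. ?g p * ?g p - 2 * c N * (?g p * u N p) + (c N)\<^sup>2 * (u N p * u N p))"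
    unfolding L2_norm_power2 L2_inner_def
    by (rule arg_cong[where f = "integral\<^sup>L _"]) (auto simp: algebra_simps power2_eq_square)
  also have "\<dots> = L2_inner S ?g ?g - 2 * c N * L2_inner S ?g (u N) + (c N)\<^sup>2 * L2_inner S (u N) (u N)"
    unfolding L2_inner_def
    using L2_mult_integrable[OF g g] L2_mult_integrable[OF g u] L2_mult_integrable[OF u u] by simp
  also have "L2_inner S ?g ?g = (L2_norm S ?g)\<^sup>2" by (simp add: L2_norm_power2)
  finally show ?case
    unfolding gN Suc by (simp add: orth power2_eq_square algebra_simps)
qed

text \<open>Fourier partial sums are the best approximations of their length, and their errors
  decrease with the length. Hence one good combination of the first \<open>N\<close> functions
  bounds the error of every partial sum with \<open>M \<ge> N\<close>.\<close>

lemma orthonormal_basis_L2I: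
  fixes u :: "nat \<Rightarrow> 'a::euclidean_space \<Rightarrow> real"
  assumes u: "\<And>n. u n \<in> L2 S"
    and orth: "\<And>m n. L2_inner S (u m) (u n) = (if m = n then 1 else 0)"
    and dense: "\<And>f e. f \<in> L2 S \<Longrightarrow> e > 0 \<Longrightarrow>
      \<exists>N c. (L2_norm S (\<lambda>p. f p - (\<Sum>n<N. c n * u n p)))\<^sup>2 < e"
  shows "orthonormal_basis_L2 S u"
  unfolding orthonormal_basis_L2_def
proof (intro conjI allI ballI u orth)
  fix f assume f: "f \<in> L2 S"
  let ?d = "\<lambda>N. L2_norm S (\<lambda>p. f p - (\<Sum>n<N. L2_inner S f (u n) * u n p))"
  show "?d \<longlonglongrightarrow> 0"
  proof (rule LIMSEQ_I)
    fix e :: real assume e: "e > 0"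
    obtain N c where Nc: "(L2_norm S (\<lambda>p. f p - (\<Sum>n<N. c n * u n p)))\<^sup>2 < e\<^sup>2"
      using dense[OF f, of "e\<^sup>2"] e by auto
    have "norm (?d M - 0) < e" if M: "M \<ge> N" for M
    proof -
      have "(?d M)\<^sup>2 = L2_inner S f f + (\<Sum>n<M. - (L2_inner S f (u n))\<^sup>2)"
        by (subst L2_norm_diff_sum_sq[OF u orth f]) simp
      also have "\<dots> \<le> L2_inner S f f + (\<Sum>n<N. - (L2_inner S f (u n))\<^sup>2)"
        using sum_mono2[of "{..<M}" "{..<N}" "\<lambda>n. (L2_inner S f (u n))\<^sup>2"] M
        by (simp add: sum_negf)
      also have "\<dots> \<le> L2_inner S f f + (\<Sum>n<N. (c n - L2_inner S f (u n))\<^sup>2 - (L2_inner S f (u n))\<^sup>2)"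
        by (intro add_left_mono sum_mono) simp
      also have "\<dots> < e\<^sup>2"
        using Nc by (subst (asm) L2_norm_diff_sum_sq[OF u orth f])
      finally show ?thesis
        using e by (simp add: L2_norm_nonneg power2_less_imp_less)
    qed
    then show "\<exists>no. \<forall>n\<ge>no. norm (?d n - 0) < e" by blast
  qed
qed

subsection \<open>Geometry of the triangle\<close>

text \<open>Convexity and compactness of \<open>T\<close> follow from this description, as for the
  hull of any finite set.\<close>

lemma T_convex_hull: "T = convex hull {(0, 0), (1, 0), (0, 1)}"
proof (intro equalityI subsetI)
  fix p assume "p \<in> T"
  then obtain x y where p: "p = (x, y)" "0 \<le> x" "0 \<le> y" "x + y \<le> 1"
    by (auto simp: T_def)
  have "p = (1 - x - y) *\<^sub>R (0, 0) + x *\<^sub>R (1, 0) + y *\<^sub>R (0, 1)"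
    by (simp add: p)
  moreover have "0 \<le> 1 - x - y" "1 - x - y + x + y = 1" using p by auto
  ultimately show "p \<in> convex hull {(0, 0), (1, 0), (0, 1)}"
    unfolding convex_hull_3 using p(2,3) by blast
next
  fix p :: "real \<times> real" assume "p \<in> convex hull {(0, 0), (1, 0), (0, 1)}"
  then obtain u v w :: real where "0 \<le> u" "0 \<le> v" "0 \<le> w" "u + v + w = 1"
    and "p = u *\<^sub>R (0, 0) + v *\<^sub>R (1, 0) + w *\<^sub>R (0, 1)"
    unfolding convex_hull_3 by blast
  then show "p \<in> T" by (simp add: T_def)
qed

lemma convex_T: "convex T" and compact_T: "compact T" and closed_T: "closed T"
  unfolding T_convex_hull
  by (simp_all add: finite_imp_compact_convex_hull compact_imp_closed)

lemma T_lebesgue [measurable, simp]: "T \<in> sets lebesgue"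
  using compact_T lmeasurable_compact by blast

text \<open>Tietze extends \<open>f\<close> continuously to the plane; the extension is integrable
  on a box around \<open>T\<close>, hence on \<open>T\<close>.\<close>

lemma continuous_imp_integrable_T:
  fixes f :: "real \<times> real \<Rightarrow> real"
  assumes "continuous_on T f"
  shows "integrable (lebesgue_on T) f"
proof -
  obtain a where a: "T \<subseteq> cbox (-a) a"
    using compact_imp_bounded[OF compact_T] bounded_subset_cbox_symmetric by blast
  have "closedin (top_of_set UNIV) T" using closed_T by simp
  from Tietze_unbounded[OF assms this] obtain g
    where gc: "continuous_on UNIV g" and g: "\<And>p. p \<in> T \<Longrightarrow> g p = f p" by metis
  have "continuous_on (cbox (-a) a) g" using gc continuous_on_subset by blast
  then have "g absolutely_integrable_on cbox (-a) a"
    by (rule absolutely_integrable_continuous)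
  then have "g absolutely_integrable_on T"
    by (rule set_integrable_subset) (simp_all add: a)
  then have "integrable (lebesgue_on T) g"
    by (rule absolutely_integrable_imp_integrable) simp
  moreover have "integrable (lebesgue_on T) g \<longleftrightarrow> integrable (lebesgue_on T) f"
    by (rule Bochner_Integration.integrable_cong) (use g in simp_all)
  ultimately show ?thesis by simp
qed

lemma frontier_T: "frontier T \<subseteq> {p \<in> T. fst p = 0 \<or> snd p = 0 \<or> fst p + snd p = 1}"
proof
  fix p assume p: "p \<in> frontier T"
  have "p \<in> T"
    using p closed_T frontier_subset_closed by blast
  let ?U = "{p :: real \<times> real. 0 < fst p \<and> 0 < snd p \<and> fst p + snd p < 1}"
  have "open ?U"
    by (intro open_Collect_conj open_Collect_less continuous_intros)
  moreover have "?U \<subseteq> T" by (auto simp: T_def)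
  ultimately have "?U \<subseteq> interior T" by (rule interior_maximal[rotated])
  then have "p \<notin> ?U" using p by (auto simp: frontier_def)
  with \<open>p \<in> T\<close> show "p \<in> {p \<in> T. fst p = 0 \<or> snd p = 0 \<or> fst p + snd p = 1}"
    by (auto simp: T_def)
qed

text \<open>The segment from \<open>p\<close> to any \<open>q\<close> in \<open>T\<close> stays in
  \<open>T\<close>, and the one-sided derivative along it is unique, so the difference
  \<open>L\<close> of the two derivatives kills \<open>q - p\<close>. Thus \<open>L\<close> takes
  the same value at all points of \<open>T\<close>; the origin makes this value 0, and the other two
  vertices form a basis of the plane. The argument covers boundary points and vertices.\<close>

lemma has_derivative_within_T_unique:
  fixes f :: "real \<times> real \<Rightarrow> real"
  assumes p: "p \<in> T" and f': "(f has_derivative f') (at p within T)"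
    and f'': "(f has_derivative f'') (at p within T)"
  shows "f' = f''"
proof -
  define L where "L = (\<lambda>v. f' v - f'' v)"
  have L: "((\<lambda>_. 0) has_derivative L) (at p within T)"
    using has_derivative_diff[OF f' f''] by (simp add: L_def)
  interpret L: bounded_linear L using L by (rule has_derivative_bounded_linear)
  have zero: "L (q - p) = 0" if q: "q \<in> T" for q
  proof -
    define c where "c = (\<lambda>t :: real. p + t *\<^sub>R (q - p))"
    have c: "(c has_derivative (\<lambda>t. t *\<^sub>R (q - p))) (at 0 within {0..1})"
      unfolding c_def by (auto intro!: derivative_eq_intros)
    have "c ` {0..1} \<subseteq> T"
    proof
      fix r assume "r \<in> c ` {0..1}"
      then obtain t where t: "t \<in> {0..1}" "r = (1 - t) *\<^sub>R p + t *\<^sub>R q"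
        by (auto simp: c_def algebra_simps)
      then show "r \<in> T" using convexD[OF convex_T p q, of "1 - t" t] by auto
    qed
    then have "((\<lambda>_. 0) has_derivative L) (at (c 0) within c ` {0..1})"
      using has_derivative_subset[OF L] by (simp add: c_def)
    from has_derivative_in_compose[OF c this]
    have "((\<lambda>_. 0) has_derivative (\<lambda>t. L (t *\<^sub>R (q - p)))) (at 0 within {0..1})" .
    moreover have "((\<lambda>_. 0 :: real) has_derivative (\<lambda>t::real. 0)) (at 0 within {0..1})"
      by simp
    ultimately have "(\<lambda>t. L (t *\<^sub>R (q - p))) = (\<lambda>t. 0)"
      by (intro frechet_derivative_unique_within_closed_interval
          [of "0 :: real" 1 0 "\<lambda>_. 0 :: real"]) simp_all
    from fun_cong[OF this, of 1] show ?thesis by simp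
  qed
  have eq: "L q = L p" if "q \<in> T" for q
    using zero[OF that] by (simp add: L.diff)
  have L0: "L p = 0" using eq[of "(0, 0)"] L.zero by (simp add: T_def zero_prod_def)
  have "L v = 0" for v
  proof -
    have "v = fst v *\<^sub>R (1, 0) + snd v *\<^sub>R (0, 1)" by (cases v) auto
    then have "L v = fst v * L (1, 0) + snd v * L (0, 1)"
      by (metis L.add L.scaleR real_scaleR_def)
    then show ?thesis using eq[of "(1, 0)"] eq[of "(0, 1)"] L0 by (simp add: T_def)
  qed
  then show ?thesis by (auto simp: L_def fun_eq_iff)
qed

text \<open>\<open>frechet_derivative\<close> is some chosen derivative; uniqueness within
  \<open>T\<close> identifies it with any derivative that is exhibited explicitly.\<close>

lemma dir_deriv_eqI:
  assumes "p \<in> T" "(f has_derivative f') (at p within T)"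
  shows "dir_deriv v f p = f' v"
proof -
  have "(f has_derivative frechet_derivative f (at p within T)) (at p within T)"
    using assms(2) frechet_derivative_works differentiable_def by blast
  then show ?thesis
    using has_derivative_within_T_unique[OF assms(1) _ assms(2)] by (auto simp: dir_deriv_def)
qed

subsection \<open>Weighted continuous functions are dense\<close>

lemma continuous_imp_L2_T: "continuous_on T f \<Longrightarrow> f \<in> L2 T"
  unfolding L2_def
  by (intro CollectI conjI borel_measurable_integrable continuous_imp_integrable_T
      continuous_on_power)

text \<open>This is dominated convergence for the squares: the majorant \<open>w\<close> bounds
  \<open>(g n p)\<^sup>2\<close>, not \<open>g n p\<close>.\<close>

lemma L2_norm_sq_tendsto_0:
  assumes w: "w \<in> borel_measurable (lebesgue_on S)" "integrable (lebesgue_on S) w"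
    and g: "\<And>n. g n \<in> borel_measurable (lebesgue_on S)"
    and bound: "\<And>n. AE p in lebesgue_on S. (g n p)\<^sup>2 \<le> w p"
    and lim: "AE p in lebesgue_on S. (\<lambda>n. g n p) \<longlonglongrightarrow> 0"
  shows "(\<lambda>n. (L2_norm S (g n))\<^sup>2) \<longlonglongrightarrow> 0"
proof -
  have "(\<lambda>n. LINT p|lebesgue_on S. (g n p)\<^sup>2) \<longlonglongrightarrow> (LINT p|lebesgue_on S. 0)"
  proof (rule integral_dominated_convergence[where w = w])
    show "AE p in lebesgue_on S. (\<lambda>n. (g n p)\<^sup>2) \<longlonglongrightarrow> 0"
      using lim by eventually_elim (auto intro!: tendsto_eq_intros)
    show "AE p in lebesgue_on S. norm ((g n p)\<^sup>2) \<le> w p" for n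
      using bound[of n] by eventually_elim simp
  qed (use w g in auto)
  then show ?thesis by (simp add: L2_norm_def)
qed

lemma AE_lebesgue_on_not_negligible:
  assumes "negligible N" "S \<in> sets lebesgue"
  shows "AE p in lebesgue_on S. p \<in> S \<and> p \<notin> N"
proof -
  have "AE p in lebesgue. p \<notin> N"
    using assms(1) by (intro AE_not_in) (simp add: negligible_iff_null_sets)
  then have "AE p in lebesgue. p \<in> S \<longrightarrow> p \<in> S \<and> p \<notin> N"
    by eventually_elim simp
  then show ?thesis
    using assms(2) by (simp add: AE_restrict_space_iff)
qed

lemma LIMSEQ_0_imp_less:
  fixes X :: "nat \<Rightarrow> real"
  assumes "X \<longlonglongrightarrow> 0" "e > 0"
  shows "\<exists>n. X n < e"
  using eventually_happens'[OF _ order_tendstoD(2)[OF assms]] by auto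

text \<open>Truncating \<open>a / w\<close> at height \<open>M\<close> and multiplying back
  truncates \<open>a\<close> at height \<open>M * w\<close>. This moves \<open>a\<close> towards 0
  without crossing it, so what was cut off is no larger than \<open>a\<close>.\<close>

lemma clip_between:
  fixes a w :: real
  assumes "w > 0" "M \<ge> 0"
  shows "\<bar>a - max (- M) (min M (a / w)) * w\<bar> \<le> \<bar>a\<bar>"
proof -
  have "0 \<le> M * w" using assms by simp
  consider "M * w < a" | "a < - (M * w)" | "- (M * w) \<le> a" "a \<le> M * w" by linarith
  then show ?thesis
  proof cases
    case 1
    then have "M < a / w" using assms by (simp add: field_simps)
    then have "max (- M) (min M (a / w)) * w = M * w" using assms by simp
    then show ?thesis using 1 \<open>0 \<le> M * w\<close> by linarith
  next
    case 2
    then have "a / w < - M" using assms by (simp add: field_simps)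
    then have "max (- M) (min M (a / w)) * w = - (M * w)" using assms by simp
    then show ?thesis using 2 \<open>0 \<le> M * w\<close> by linarith
  next
    case 3
    then have "- M \<le> a / w" "a / w \<le> M" using assms by (simp_all add: field_simps)
    then show ?thesis using assms by simp
  qed
qed

text \<open>The natural candidate \<open>f / w\<close> may be unbounded near the zeros of
  \<open>w\<close>. It is first truncated, and the truncation is then replaced by a continuous
  function; dominated convergence controls both errors after multiplication by
  \<open>w\<close>.\<close>

lemma weighted_continuous_dense:
  assumes w: "continuous_on T w" and pos: "negligible {p \<in> T. w p \<le> 0}"
    and f: "f \<in> L2 T" and e: "e > 0"
  shows "\<exists>g. continuous_on T g \<and> (L2_norm T (\<lambda>p. f p - g p * w p))\<^sup>2 < e"
proof -
  have fm: "f \<in> borel_measurable (lebesgue_on T)" using f by (simp add: L2_def)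
  have wm: "w \<in> borel_measurable (lebesgue_on T)"
    using continuous_imp_integrable_T[OF w] by auto
  have AE_pos: "AE p in lebesgue_on T. w p > 0"
    using AE_lebesgue_on_not_negligible[OF pos T_lebesgue] by eventually_elim auto
  define clip where "clip M a = max (- M) (min M a)" for M a :: real
  have clip_cont: "continuous_on UNIV (clip M)" for M
    unfolding clip_def by (intro continuous_intros)
  have clip_m: "clip M \<in> borel_measurable borel" for M
    by (rule borel_measurable_continuous_onI[OF clip_cont])
  have clip_bound: "\<bar>clip M a\<bar> \<le> M" if "M \<ge> 0" for M a
    using that by (auto simp: clip_def)
  have fwm: "(\<lambda>p. f p / w p) \<in> borel_measurable (lebesgue_on T)"
    by (rule borel_measurable_divide[OF fm wm])
  have Fm: "(\<lambda>p. clip M (f p / w p)) \<in> borel_measurable (lebesgue_on T)" for M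
    by (rule measurable_compose[OF fwm clip_m])
  \<comment> \<open>Where \<open>w p > 0\<close>, the error is 0 as soon as \<open>real n\<close>
    exceeds the modulus of \<open>f p / w p\<close>, and \<open>clip_between\<close> bounds it by
    that of \<open>f p\<close>.\<close>
  have "(\<lambda>n. (L2_norm T (\<lambda>p. f p - clip (real n) (f p / w p) * w p))\<^sup>2) \<longlonglongrightarrow> 0"
  proof (rule L2_norm_sq_tendsto_0[where w = "\<lambda>p. (f p)\<^sup>2"])
    show "integrable (lebesgue_on T) (\<lambda>p. (f p)\<^sup>2)" using f by (simp add: L2_def)
    show "AE p in lebesgue_on T. (f p - clip (real n) (f p / w p) * w p)\<^sup>2 \<le> (f p)\<^sup>2" for n
      using AE_pos
    proof eventually_elim
      case (elim p)
      then show ?case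
        using clip_between[of "w p" "real n" "f p"] by (simp add: clip_def abs_le_square_iff)
    qed
    show "AE p in lebesgue_on T. (\<lambda>n. f p - clip (real n) (f p / w p) * w p) \<longlonglongrightarrow> 0"
      using AE_pos
    proof eventually_elim
      case (elim p)
      obtain N :: nat where N: "\<bar>f p / w p\<bar> \<le> real N" using real_arch_simple by blast
      have "f p - clip (real n) (f p / w p) * w p = 0" if "n \<ge> N" for n
      proof -
        have "clip (real n) (f p / w p) = f p / w p"
          using N that unfolding clip_def by linarith
        then show ?thesis using elim by simp
      qed
      then show ?case by (intro tendsto_eventually eventually_sequentiallyI) auto
    qed
  qed (use Fm fm wm in simp_all)
  \<comment> \<open>Both errors are kept below \<open>e / 4\<close> because
    \<open>L2_norm_triangle_sq\<close> doubles each of them.\<close>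
  from LIMSEQ_0_imp_less[OF this, of "e / 4"]
  obtain n where n: "(L2_norm T (\<lambda>p. f p - clip (real n) (f p / w p) * w p))\<^sup>2 < e / 4"
    using e by auto
  let ?F = "\<lambda>p. clip (real n) (f p / w p)"
  \<comment> \<open>The definition of \<open>measurable_on\<close> supplies continuous functions
    that converge to the quotient off a negligible set. Clipping them at the same height gives the
    majorant \<open>(2 * real n * w p)\<^sup>2\<close>.\<close>
  have "(\<lambda>p. f p / w p) measurable_on T"
    using fwm by (subst measurable_on_iff_borel_measurable) simp_all
  then obtain N g where N: "negligible N" and g: "\<And>k. continuous_on UNIV (g k)"
    and gF: "\<And>p. p \<notin> N \<Longrightarrow> (\<lambda>k. g k p) \<longlonglongrightarrow> (if p \<in> T then f p / w p else 0)"
    unfolding measurable_on_def by blast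
  have gc: "continuous_on T (\<lambda>p. clip (real n) (g k p))" for k
    using continuous_on_compose2[OF clip_cont continuous_on_subset[OF g]] by auto
  have gm: "(\<lambda>p. clip (real n) (g k p)) \<in> borel_measurable (lebesgue_on T)" for k
    using continuous_imp_integrable_T[OF gc] by auto
  note AE_N = AE_lebesgue_on_not_negligible[OF N T_lebesgue]
  have "(\<lambda>k. (L2_norm T (\<lambda>p. (?F p - clip (real n) (g k p)) * w p))\<^sup>2) \<longlonglongrightarrow> 0"
  proof (rule L2_norm_sq_tendsto_0[where w = "\<lambda>p. (2 * real n * w p)\<^sup>2"])
    show "integrable (lebesgue_on T) (\<lambda>p. (2 * real n * w p)\<^sup>2)"
      by (intro continuous_imp_integrable_T continuous_intros w)
    have "((?F p - clip (real n) (g k p)) * w p)\<^sup>2 \<le> (2 * real n * w p)\<^sup>2" for k p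
    proof -
      have "\<bar>?F p - clip (real n) (g k p)\<bar> \<le> 2 * real n"
        using clip_bound[of "real n" "f p / w p"] clip_bound[of "real n" "g k p"] by linarith
      then show ?thesis
        by (simp add: abs_le_square_iff[symmetric] abs_mult mult_right_mono)
    qed
    then show "AE p in lebesgue_on T. ((?F p - clip (real n) (g k p)) * w p)\<^sup>2 \<le> (2 * real n * w p)\<^sup>2" for k
      by simp
    show "AE p in lebesgue_on T. (\<lambda>k. (?F p - clip (real n) (g k p)) * w p) \<longlonglongrightarrow> 0"
      using AE_N
    proof eventually_elim
      case (elim p)
      have "isCont (clip (real n)) (f p / w p)"
        using clip_cont by (simp add: continuous_on_eq_continuous_at)
      then have "(\<lambda>k. clip (real n) (g k p)) \<longlonglongrightarrow> ?F p"
        using gF[of p] elim by (auto intro: isCont_tendsto_compose)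
      then have "(\<lambda>k. (?F p - clip (real n) (g k p)) * w p) \<longlonglongrightarrow> (?F p - ?F p) * w p"
        by (intro tendsto_intros)
      then show ?case by simp
    qed
  qed (use Fm gm wm in simp_all)
  from LIMSEQ_0_imp_less[OF this, of "e / 4"]
  obtain k where k: "(L2_norm T (\<lambda>p. (?F p - clip (real n) (g k p)) * w p))\<^sup>2 < e / 4"
    using e by auto
  have Fw: "(\<lambda>p. ?F p * w p) \<in> L2 T"
  proof -
    have "integrable (lebesgue_on T) (\<lambda>p. (?F p * w p)\<^sup>2)"
    proof (rule Bochner_Integration.integrable_bound)
      show "integrable (lebesgue_on T) (\<lambda>p. (real n * w p)\<^sup>2)"
        by (intro continuous_imp_integrable_T continuous_intros w)
      show "AE p in lebesgue_on T. norm ((?F p * w p)\<^sup>2) \<le> norm ((real n * w p)\<^sup>2)"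
        using clip_bound[of "real n"]
        by (intro AE_I2) (simp add: abs_le_square_iff[symmetric] abs_mult mult_right_mono)
    qed (use Fm wm in simp)
    then show ?thesis using Fm wm by (simp add: L2_def)
  qed
  let ?g = "\<lambda>p. clip (real n) (g k p)"
  have gw: "(\<lambda>p. ?g p * w p) \<in> L2 T"
    by (intro continuous_imp_L2_T continuous_on_mult gc w)
  have "(L2_norm T (\<lambda>p. (f p - ?F p * w p) + (?F p * w p - ?g p * w p)))\<^sup>2
      \<le> 2 * (L2_norm T (\<lambda>p. f p - ?F p * w p))\<^sup>2 + 2 * (L2_norm T (\<lambda>p. ?F p * w p - ?g p * w p))\<^sup>2"
    by (intro L2_norm_triangle_sq L2_diff f Fw gw)
  also have "\<dots> < e"
    using n k by (simp add: left_diff_distrib)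
  finally show ?thesis using gc by (intro exI[of _ ?g]) simp
qed

subsection \<open>Completeness of the antisymmetric modes\<close>

definition sin_pi :: "int \<Rightarrow> real \<Rightarrow> real" where
  "sin_pi k x = sin (of_int k * pi * x)"

definition cos_pi :: "int \<Rightarrow> real \<Rightarrow> real" where
  "cos_pi k x = cos (of_int k * pi * x)"

text \<open>This is (-1)^(m + n), written as a case distinction since the exponent may be
  negative.\<close>

definition parity_sign :: "int \<Rightarrow> int \<Rightarrow> real" where
  "parity_sign m n = (if even (m + n) then 1 else -1)"

definition tri_mode :: "int \<Rightarrow> int \<Rightarrow> real \<times> real \<Rightarrow> real" where
  "tri_mode m n p = sin_pi m (fst p) * sin_pi n (snd p) -
     parity_sign m n * (sin_pi n (fst p) * sin_pi m (snd p))"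

lemma continuous_on_sin_pi [continuous_intros]:
  fixes f :: "'a::t2_space \<Rightarrow> real"
  shows
  "continuous_on S f \<Longrightarrow> continuous_on S (\<lambda>p. sin_pi k (f p))"
  unfolding sin_pi_def by (intro continuous_intros)

lemma continuous_on_cos_pi [continuous_intros]:
  fixes f :: "'a::t2_space \<Rightarrow> real"
  shows
  "continuous_on S f \<Longrightarrow> continuous_on S (\<lambda>p. cos_pi k (f p))"
  unfolding cos_pi_def by (intro continuous_intros)

lemma continuous_on_tri_mode: "continuous_on S (tri_mode m n)"
  unfolding tri_mode_def by (intro continuous_intros)

lemma sin_pi_minus: "sin_pi (- k) x = - sin_pi k x"
  by (simp add: sin_pi_def)

lemma sin_pi_0: "sin_pi 0 x = 0"
  by (simp add: sin_pi_def)

lemma parity_sign_square: "parity_sign m n * parity_sign m n = 1"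
  by (simp add: parity_sign_def)

lemma parity_sign_commute: "parity_sign n m = parity_sign m n"
  by (simp add: parity_sign_def add.commute)

text \<open>This symmetry, the two sign rules and the degenerate cases below reduce every pair of
  integers to one with \<open>0 < n\<close> and \<open>n < m\<close>.\<close>

lemma tri_mode_commute: "tri_mode n m p = - parity_sign m n * tri_mode m n p"
proof -
  have "parity_sign m n * (parity_sign m n * a) = a" for a
    by (simp add: parity_sign_square flip: mult.assoc)
  then show ?thesis
    by (simp add: tri_mode_def parity_sign_commute[of n m] algebra_simps)
qed

lemma tri_mode_minus1: "tri_mode (- m) n p = - tri_mode m n p"
  by (simp add: tri_mode_def parity_sign_def sin_pi_minus)

lemma tri_mode_minus2: "tri_mode m (- n) p = - tri_mode m n p"
  by (simp add: tri_mode_def parity_sign_def sin_pi_minus)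

lemma tri_mode_degenerate: "m = 0 \<or> n = 0 \<or> m = n \<Longrightarrow> tri_mode m n p = 0"
  by (auto simp: tri_mode_def parity_sign_def sin_pi_0)

lemma cos_mult_sin_pi: "cos_pi 1 x * sin_pi k x = (sin_pi (k + 1) x + sin_pi (k - 1) x) / 2"
  by (simp add: cos_pi_def sin_pi_def distrib_right left_diff_distrib sin_add sin_diff)

text \<open>The factor is invariant under (x, y) -> (1 - y, 1 - x), so the product stays odd under
  this reflection. A shift of one index flips \<open>parity_sign\<close>, and the minus sign between
  the two cosines compensates for that.\<close>

lemma cos_diff_mult_tri_mode:
  "(cos_pi 1 (fst p) - cos_pi 1 (snd p)) * tri_mode m n p =
    (tri_mode (m + 1) n p + tri_mode (m - 1) n p - tri_mode m (n + 1) p - tri_mode m (n - 1) p) / 2"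
proof -
  have s: "parity_sign (m + 1) n = - parity_sign m n" "parity_sign (m - 1) n = - parity_sign m n"
    "parity_sign m (n + 1) = - parity_sign m n" "parity_sign m (n - 1) = - parity_sign m n"
    by (simp_all add: parity_sign_def)
  have "(cos_pi 1 (fst p) - cos_pi 1 (snd p)) * tri_mode m n p =
      (cos_pi 1 (fst p) * sin_pi m (fst p)) * sin_pi n (snd p) -
      parity_sign m n * ((cos_pi 1 (fst p) * sin_pi n (fst p)) * sin_pi m (snd p)) -
      sin_pi m (fst p) * (cos_pi 1 (snd p) * sin_pi n (snd p)) +
      parity_sign m n * (sin_pi n (fst p) * (cos_pi 1 (snd p) * sin_pi m (snd p)))"
    by (simp add: tri_mode_def algebra_simps)
  then show ?thesis
    unfolding cos_mult_sin_pi tri_mode_def s by (simp add: field_simps)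
qed

text \<open>This factor is invariant under the reflection too; both indices shift at once, so
  \<open>parity_sign\<close> is preserved.\<close>

lemma cos_mult_cos_mult_tri_mode:
  "(cos_pi 1 (fst p) * cos_pi 1 (snd p)) * tri_mode m n p =
    (tri_mode (m + 1) (n + 1) p + tri_mode (m + 1) (n - 1) p +
     tri_mode (m - 1) (n + 1) p + tri_mode (m - 1) (n - 1) p) / 4"
proof -
  have s: "parity_sign (m + 1) (n + 1) = parity_sign m n" "parity_sign (m - 1) (n + 1) = parity_sign m n"
    "parity_sign (m + 1) (n - 1) = parity_sign m n" "parity_sign (m - 1) (n - 1) = parity_sign m n"
    by (simp_all add: parity_sign_def)
  have "(cos_pi 1 (fst p) * cos_pi 1 (snd p)) * tri_mode m n p =
      (cos_pi 1 (fst p) * sin_pi m (fst p)) * (cos_pi 1 (snd p) * sin_pi n (snd p)) -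
      parity_sign m n * ((cos_pi 1 (fst p) * sin_pi n (fst p)) * (cos_pi 1 (snd p) * sin_pi m (snd p)))"
    by (simp add: tri_mode_def algebra_simps)
  then show ?thesis
    unfolding cos_mult_sin_pi tri_mode_def s by (simp add: field_simps)
qed

section \<open>Finite linear combinations of a sequence of functions\<close>

definition lin_span :: "(nat \<Rightarrow> 'a \<Rightarrow> real) \<Rightarrow> ('a \<Rightarrow> real) set" where
  "lin_span u = {f. \<exists>N c. f = (\<lambda>p. \<Sum>n<N. c n * u n p)}"

lemma lin_spanI:
  assumes "\<And>p. f p = (\<Sum>n<N. c n * u n p)"
  shows "f \<in> lin_span u"
  unfolding lin_span_def using assms by (intro CollectI exI[of _ N] exI[of _ c] ext)

lemma lin_span_base: "u n \<in> lin_span u"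
  by (rule lin_spanI[where N = "Suc n" and c = "\<lambda>k. if k = n then 1 else 0"]) simp

lemma lin_span_cmult:
  assumes "f \<in> lin_span u"
  shows "(\<lambda>p. a * f p) \<in> lin_span u"
proof -
  obtain N c where "f = (\<lambda>p. \<Sum>n<N. c n * u n p)" using assms unfolding lin_span_def by blast
  then show ?thesis
    by (intro lin_spanI[where N = N and c = "\<lambda>n. a * c n"]) (simp add: sum_distrib_left mult.assoc)
qed

text \<open>Combinations run over initial segments, the form used in
  \<open>orthonormal_basis_L2I\<close>, so two of different lengths are padded with zero
  coefficients to the longer one.\<close>

lemma lin_span_add:
  assumes "f \<in> lin_span u" "g \<in> lin_span u"
  shows "(\<lambda>p. f p + g p) \<in> lin_span u"
proof -
  obtain N c where f: "f = (\<lambda>p. \<Sum>n<N. c n * u n p)" using assms(1) unfolding lin_span_def by blast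
  obtain M d where g: "g = (\<lambda>p. \<Sum>n<M. d n * u n p)" using assms(2) unfolding lin_span_def by blast
  have pad: "(\<Sum>n<K. b n * u n p) = (\<Sum>n<max N M. (if n < K then b n else 0) * u n p)"
    if "K \<le> max N M" for K b p
    using that by (intro sum.mono_neutral_cong_left) auto
  show ?thesis
  proof (rule lin_spanI)
    show "f p + g p =
        (\<Sum>n<max N M. ((if n < N then c n else 0) + (if n < M then d n else 0)) * u n p)" for p
      unfolding f g by (subst (1 2) pad) (simp_all add: sum.distrib distrib_right)
  qed
qed

lemma lin_span_0: "(\<lambda>p. 0) \<in> lin_span u"
  using lin_span_cmult[OF lin_span_base, of 0] by simp

lemma lin_span_diff:
  assumes "f \<in> lin_span u" "g \<in> lin_span u"
  shows "(\<lambda>p. f p - g p) \<in> lin_span u"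
  using lin_span_add[OF assms(1) lin_span_cmult[OF assms(2), of "-1"]] by simp

lemma lin_span_mult_closed:
  assumes base: "\<And>n. (\<lambda>p. a p * u n p) \<in> lin_span u" and f: "f \<in> lin_span u"
  shows "(\<lambda>p. a p * f p) \<in> lin_span u"
proof -
  obtain N c where f: "f = (\<lambda>p. \<Sum>n<N. c n * u n p)" using f unfolding lin_span_def by blast
  have "(\<lambda>p. \<Sum>n<N. c n * (a p * u n p)) \<in> lin_span u"
    by (induction N) (simp_all add: lin_span_0 lin_span_add lin_span_cmult base)
  then show ?thesis unfolding f by (simp add: sum_distrib_left mult.left_commute)
qed

text \<open>The factor 2 normalises, since \<open>tri_mode\<close> has squared norm 1/4 on
  \<open>T\<close>. The map \<open>e\<close> is meant to enumerate
  \<open>mode_pairs\<close>.\<close>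

definition tri_basis :: "(nat \<Rightarrow> int \<times> int) \<Rightarrow> nat \<Rightarrow> real \<times> real \<Rightarrow> real" where
  "tri_basis e i p = 2 * tri_mode (fst (e i)) (snd (e i)) p"

definition mode_pairs :: "(int \<times> int) set" where
  "mode_pairs = {(m, n). 0 < n \<and> n < m}"

text \<open>The admissible indices are enlarged in stages: pairs in \<open>mode_pairs\<close>, then
  positive pairs by swapping, then arbitrary \<open>m\<close> and finally arbitrary \<open>n\<close>
  by a change of sign. Modes with a zero index or equal indices vanish.\<close>

lemma tri_mode_in_lin_span:
  assumes e: "bij_betw e UNIV mode_pairs"
  shows "tri_mode m n \<in> lin_span (tri_basis e)"
proof -
  have degenerate: "tri_mode m n \<in> lin_span (tri_basis e)" if "m = 0 \<or> n = 0 \<or> m = n" for m n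
  proof -
    have "tri_mode m n = (\<lambda>p. 0)" using tri_mode_degenerate[OF that] by blast
    then show ?thesis by (simp add: lin_span_0)
  qed
  have ordered: "tri_mode m n \<in> lin_span (tri_basis e)" if "0 < n" "n < m" for m n
  proof -
    have "(m, n) \<in> range e" using that e by (simp add: bij_betw_def mode_pairs_def)
    then obtain i where "e i = (m, n)" by auto
    then have "tri_mode m n = (\<lambda>p. 1 / 2 * tri_basis e i p)" by (simp add: tri_basis_def)
    then show ?thesis using lin_span_cmult[OF lin_span_base, of "1 / 2" "tri_basis e" i] by simp
  qed
  have positive: "tri_mode m n \<in> lin_span (tri_basis e)" if "0 < m" "0 < n" for m n
  proof -
    have "tri_mode m n = (\<lambda>p. - parity_sign n m * tri_mode n m p)"
      using tri_mode_commute by blast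
    moreover have "(\<lambda>p. - parity_sign n m * tri_mode n m p) \<in> lin_span (tri_basis e)" if "m < n"
      using \<open>0 < m\<close> that by (intro lin_span_cmult ordered)
    ultimately show ?thesis
      using that by (metis degenerate linorder_neqE ordered)
  qed
  have half: "tri_mode m n \<in> lin_span (tri_basis e)" if "0 < n" for m n
  proof -
    have "tri_mode m n = (\<lambda>p. -1 * tri_mode (- m) n p)"
      by (simp add: tri_mode_minus1)
    moreover have "(\<lambda>p. -1 * tri_mode (- m) n p) \<in> lin_span (tri_basis e)" if "m < 0"
      using \<open>0 < n\<close> that by (intro lin_span_cmult positive) simp_all
    ultimately show ?thesis
      using that by (metis degenerate linorder_neqE positive)
  qed
  have "tri_mode m n = (\<lambda>p. -1 * tri_mode m (- n) p)"
    by (simp add: tri_mode_minus2)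
  moreover have "(\<lambda>p. -1 * tri_mode m (- n) p) \<in> lin_span (tri_basis e)" if "n < 0"
    using that by (intro lin_span_cmult half) simp_all
  ultimately show ?thesis
    by (metis degenerate linorder_neqE half)
qed

section \<open>Density by Stone--Weierstrass\<close>

text \<open>With \<open>a\<close> = cos \<pi>x and \<open>t\<close> = - cos \<pi>y, the two
  functions give the sum and, up to sign, the product of \<open>a\<close> and \<open>t\<close>,
  hence the unordered pair. In the triangle y \<le> 1 - x, which forces \<open>t \<le> a\<close> and
  so fixes the order; the cosine is injective on [0, \<pi>].\<close>

lemma cos_pi_separates_T:
  assumes "p \<in> T" "q \<in> T"
    and diff: "cos_pi 1 (fst p) - cos_pi 1 (snd p) = cos_pi 1 (fst q) - cos_pi 1 (snd q)"
    and prod: "cos_pi 1 (fst p) * cos_pi 1 (snd p) = cos_pi 1 (fst q) * cos_pi 1 (snd q)"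
  shows "p = q"
proof -
  have le: "- cos_pi 1 (snd r) \<le> cos_pi 1 (fst r)" if "r \<in> T" for r
  proof -
    have r: "0 \<le> fst r" "0 \<le> snd r" "fst r + snd r \<le> 1" using that by (auto simp: T_def)
    have "pi * snd r \<le> pi * (1 - fst r)" using r by (intro mult_left_mono) auto
    then have "pi * snd r \<le> pi - pi * fst r" by (simp add: right_diff_distrib)
    then have "cos (pi - pi * fst r) \<le> cos (pi * snd r)"
      using r by (intro cos_monotone_0_pi_le) auto
    then show ?thesis by (simp add: cos_pi_def)
  qed
  have inj: "x = y" if "cos_pi 1 x = cos_pi 1 y" "0 \<le> x" "x \<le> 1" "0 \<le> y" "y \<le> 1" for x y
  proof -
    have "pi * x \<le> pi * 1" "pi * y \<le> pi * 1"
      using that by (intro mult_left_mono; simp)+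
    moreover have "0 \<le> pi * x" "0 \<le> pi * y" using that by simp_all
    moreover have "cos (pi * x) = cos (pi * y)" using that(1) by (simp add: cos_pi_def)
    ultimately have "pi * x = pi * y" by (metis cos_inj_pi mult.right_neutral)
    then show ?thesis by simp
  qed
  define a t a' t' where "a = cos_pi 1 (fst p)" and "t = - cos_pi 1 (snd p)"
    and "a' = cos_pi 1 (fst q)" and "t' = - cos_pi 1 (snd q)"
  have st: "a + t = a' + t'" "a * t = a' * t'" "t \<le> a" "t' \<le> a'"
    using diff prod le[OF assms(1)] le[OF assms(2)] by (simp_all add: a_def t_def a'_def t'_def)
  have "(a - a') * (a - t') = a * a - a * (a' + t') + a' * t'" by (simp add: algebra_simps)
  also have "\<dots> = 0" unfolding st(1,2)[symmetric] by (simp add: algebra_simps)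
  finally have "a = a' \<or> a = t'" by simp
  \<comment> \<open>If \<open>a = t'\<close> then \<open>t = a'\<close>, and the two order relations
    make all four numbers equal.\<close>
  then have "a = a'" "t = t'" using st by auto
  then show "p = q"
    using assms(1,2) inj[of "fst p" "fst q"] inj[of "snd p" "snd q"]
    by (auto simp: a_def a'_def t_def t'_def T_def)
qed

text \<open>The mode factors as 2 sin \<pi>x sin \<pi>y (cos \<pi>x + cos \<pi>y), which is positive
  in the open triangle. The exceptional points lie on the three lines that carry the sides.\<close>

lemma tri_mode_2_1_zero_set: "negligible {p \<in> T. tri_mode 2 1 p \<le> 0}"
proof (rule negligible_subset)
  show "negligible ({p. (1, 0) \<bullet> p = (0 :: real)} \<union> {p. (0, 1) \<bullet> p = (0 :: real)} \<union>
      {p. (1, 1) \<bullet> p = (1 :: real)} :: (real \<times> real) set)"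
    by (intro negligible_Un negligible_hyperplane) (auto simp: zero_prod_def)
  show "{p \<in> T. tri_mode 2 1 p \<le> 0} \<subseteq> {p. (1, 0) \<bullet> p = (0 :: real)} \<union> {p. (0, 1) \<bullet> p = (0 :: real)} \<union>
      {p. (1, 1) \<bullet> p = (1 :: real)}"
  proof
    fix p assume p: "p \<in> {p \<in> T. tri_mode 2 1 p \<le> 0}"
    obtain x y where xy: "p = (x, y)" by (cases p)
    have "\<not> (0 < x \<and> 0 < y \<and> x + y < 1)"
    proof
      assume a: "0 < x \<and> 0 < y \<and> x + y < 1"
      have "pi * y < pi * (1 - x)" using a by (intro mult_strict_left_mono) auto
      then have "pi * y < pi - pi * x" by (simp add: right_diff_distrib)
      then have "cos (pi - pi * x) < cos (pi * y)"
        using a by (intro cos_monotone_0_pi) auto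
      then have "0 < cos (pi * x) + cos (pi * y)" by simp
      moreover have "0 < sin (pi * x)" "0 < sin (pi * y)"
        using a by (auto intro!: sin_gt_zero)
      ultimately have "0 < 2 * (sin (pi * x) * sin (pi * y)) * (cos (pi * x) + cos (pi * y))"
        by simp
      also have "\<dots> = tri_mode 2 1 p"
        using sin_double[of "pi * x"] sin_double[of "pi * y"]
        by (simp add: tri_mode_def parity_sign_def sin_pi_def xy algebra_simps)
      finally show False using p by simp
    qed
    then show "p \<in> {p. (1, 0) \<bullet> p = (0 :: real)} \<union> {p. (0, 1) \<bullet> p = (0 :: real)} \<union>
      {p. (1, 1) \<bullet> p = (1 :: real)}"
      using p by (auto simp: xy T_def)
  qed
qed

lemma tri_basis_dense:
  assumes e: "bij_betw e UNIV mode_pairs" and f: "f \<in> L2 T" and "d > 0"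
  shows "\<exists>N c. (L2_norm T (\<lambda>p. f p - (\<Sum>n<N. c n * tri_basis e n p)))\<^sup>2 < d"
proof -
  let ?V = "lin_span (tri_basis e)" and ?w = "tri_mode 2 1"
  note V = tri_mode_in_lin_span[OF e]
  \<comment> \<open>\<open>R\<close> consists of the continuous multipliers of the span. Unlike the
    span itself, whose members all vanish on the boundary, it contains the constants, and it is
    closed under products because multipliers compose.\<close>
  define R where "R = {q. continuous_on T q \<and> (\<forall>v\<in>?V. (\<lambda>p. q p * v p) \<in> ?V)}"
  have "(\<lambda>p. cos_pi 1 (fst p) - cos_pi 1 (snd p)) \<in> R"
  proof -
    have "(\<lambda>p. (cos_pi 1 (fst p) - cos_pi 1 (snd p)) * tri_basis e i p) =
        (\<lambda>p. tri_mode (fst (e i) + 1) (snd (e i)) p + tri_mode (fst (e i) - 1) (snd (e i)) p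
          - tri_mode (fst (e i)) (snd (e i) + 1) p - tri_mode (fst (e i)) (snd (e i) - 1) p)" for i
      unfolding tri_basis_def mult.left_commute[of _ 2] cos_diff_mult_tri_mode
      by (intro ext) (simp add: field_simps)
    moreover have "(\<lambda>p. tri_mode (fst (e i) + 1) (snd (e i)) p + tri_mode (fst (e i) - 1) (snd (e i)) p
          - tri_mode (fst (e i)) (snd (e i) + 1) p - tri_mode (fst (e i)) (snd (e i) - 1) p) \<in> ?V" for i
      by (intro lin_span_add lin_span_diff V)
    ultimately have "(\<lambda>p. (cos_pi 1 (fst p) - cos_pi 1 (snd p)) * tri_basis e i p) \<in> ?V" for i
      by simp
    from lin_span_mult_closed[OF this] show ?thesis
      unfolding R_def by (intro CollectI conjI ballI continuous_intros)
  qed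
  moreover have "(\<lambda>p. cos_pi 1 (fst p) * cos_pi 1 (snd p)) \<in> R"
  proof -
    have "(\<lambda>p. (cos_pi 1 (fst p) * cos_pi 1 (snd p)) * tri_basis e i p) =
        (\<lambda>p. 1 / 2 * (tri_mode (fst (e i) + 1) (snd (e i) + 1) p + tri_mode (fst (e i) + 1) (snd (e i) - 1) p
          + tri_mode (fst (e i) - 1) (snd (e i) + 1) p + tri_mode (fst (e i) - 1) (snd (e i) - 1) p))" for i
      unfolding tri_basis_def mult.left_commute[of _ 2] cos_mult_cos_mult_tri_mode
      by (intro ext) (simp add: field_simps)
    moreover have "(\<lambda>p. 1 / 2 * (tri_mode (fst (e i) + 1) (snd (e i) + 1) p + tri_mode (fst (e i) + 1) (snd (e i) - 1) p
          + tri_mode (fst (e i) - 1) (snd (e i) + 1) p + tri_mode (fst (e i) - 1) (snd (e i) - 1) p)) \<in> ?V" for i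
      by (intro lin_span_cmult lin_span_add V)
    ultimately have "(\<lambda>p. (cos_pi 1 (fst p) * cos_pi 1 (snd p)) * tri_basis e i p) \<in> ?V" for i
      by simp
    from lin_span_mult_closed[OF this] show ?thesis
      unfolding R_def by (intro CollectI conjI ballI continuous_intros)
  qed
  ultimately interpret function_ring_on R T
  proof unfold_locales
    assume ab: "(\<lambda>p. cos_pi 1 (fst p) - cos_pi 1 (snd p)) \<in> R"
      "(\<lambda>p. cos_pi 1 (fst p) * cos_pi 1 (snd p)) \<in> R"
    show "compact T" by (rule compact_T)
    show "continuous_on T f" if "f \<in> R" for f using that by (simp add: R_def)
    show "(\<lambda>p. f p + g p) \<in> R" if "f \<in> R" "g \<in> R" for f g
      using that by (auto simp: R_def distrib_right intro: continuous_on_add lin_span_add)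
    show "(\<lambda>p. f p * g p) \<in> R" if "f \<in> R" "g \<in> R" for f g
      using that by (auto simp: R_def mult.assoc intro: continuous_on_mult)
    show "(\<lambda>p. c) \<in> R" for c
      by (auto simp: R_def intro: lin_span_cmult)
    show "\<exists>f\<in>R. f p \<noteq> f q" if "p \<in> T" "q \<in> T" "p \<noteq> q" for p q
    proof (rule ccontr)
      assume "\<not> (\<exists>f\<in>R. f p \<noteq> f q)"
      then have n: "\<forall>f\<in>R. f p = f q" by simp
      have "p = q"
        using that(1,2) bspec[OF n ab(1)] bspec[OF n ab(2)] by (rule cos_pi_separates_T)
      with that(3) show False ..
    qed
  qed
  obtain g where g: "continuous_on T g" and fg: "(L2_norm T (\<lambda>p. f p - g p * ?w p))\<^sup>2 < d / 4"
    using weighted_continuous_dense[OF continuous_on_tri_mode tri_mode_2_1_zero_set f, of "d / 4"] \<open>d > 0\<close>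
    by auto
  define C where "C = (L2_norm T ?w)\<^sup>2"
  \<comment> \<open>The choice makes \<open>\<delta>\<^sup>2 * C\<close> smaller than
    \<open>d / 4\<close>; with \<open>C + 1\<close> the denominator is positive for every
    \<open>C \<ge> 0\<close>.\<close>
  define \<delta> where "\<delta> = sqrt (d / (4 * (C + 1)))"
  have C: "C \<ge> 0" by (simp add: C_def)
  then have \<delta>: "\<delta> > 0" using \<open>d > 0\<close> by (simp add: \<delta>_def)
  have "\<delta>\<^sup>2 = d / (4 * (C + 1))" using C \<open>d > 0\<close> by (simp add: \<delta>_def)
  then have "\<delta>\<^sup>2 * C = d / 4 * (C / (C + 1))" by simp
  also have "\<dots> < d / 4 * 1" using C \<open>d > 0\<close> by (intro mult_strict_left_mono) simp_all
  finally have \<delta>C: "\<delta>\<^sup>2 * C < d / 4" by simp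
  obtain q where q: "q \<in> R" "\<And>p. p \<in> T \<Longrightarrow> \<bar>g p - q p\<bar> < \<delta>"
    using Stone_Weierstrass_basic[OF g \<delta>] by blast
  have qc: "continuous_on T q" using q by (simp add: R_def)
  have gq: "(L2_norm T (\<lambda>p. g p * ?w p - q p * ?w p))\<^sup>2 < d / 4"
  proof -
    have "(L2_norm T (\<lambda>p. g p * ?w p - q p * ?w p))\<^sup>2 =
        (LINT p|lebesgue_on T. (g p * ?w p - q p * ?w p)\<^sup>2)"
      by (simp add: L2_norm_def)
    also have "\<dots> \<le> (LINT p|lebesgue_on T. \<delta>\<^sup>2 * (?w p)\<^sup>2)"
    proof (rule integral_mono)
      fix p assume "p \<in> space (lebesgue_on T)"
      then have "\<bar>g p - q p\<bar> \<le> \<delta>" using q(2)[of p] by simp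
      then have "(g p - q p)\<^sup>2 \<le> \<delta>\<^sup>2" using \<delta> by (simp add: abs_le_square_iff[symmetric])
      then have "(g p - q p)\<^sup>2 * (?w p)\<^sup>2 \<le> \<delta>\<^sup>2 * (?w p)\<^sup>2" by (rule mult_right_mono) simp
      then show "(g p * ?w p - q p * ?w p)\<^sup>2 \<le> \<delta>\<^sup>2 * (?w p)\<^sup>2"
        by (simp add: left_diff_distrib[symmetric] power_mult_distrib)
    qed (intro continuous_imp_integrable_T continuous_intros g qc continuous_on_tri_mode)+
    also have "\<dots> = \<delta>\<^sup>2 * C" by (simp add: C_def L2_norm_def)
    finally show ?thesis using \<delta>C by simp
  qed
  have "(L2_norm T (\<lambda>p. (f p - g p * ?w p) + (g p * ?w p - q p * ?w p)))\<^sup>2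
      \<le> 2 * (L2_norm T (\<lambda>p. f p - g p * ?w p))\<^sup>2 + 2 * (L2_norm T (\<lambda>p. g p * ?w p - q p * ?w p))\<^sup>2"
    by (intro L2_norm_triangle_sq L2_diff f continuous_imp_L2_T continuous_on_mult g qc
        continuous_on_tri_mode)
  also have "\<dots> < d" using fg gq by simp
  finally have fq: "(L2_norm T (\<lambda>p. f p - q p * ?w p))\<^sup>2 < d" by simp
  \<comment> \<open>The weight \<open>?w\<close> is itself a mode, so the multiplier
    \<open>q\<close> carries it into the span.\<close>
  have "(\<lambda>p. q p * ?w p) \<in> ?V" using q(1) V by (simp add: R_def)
  then obtain N c where "(\<lambda>p. q p * ?w p) = (\<lambda>p. \<Sum>n<N. c n * tri_basis e n p)"
    unfolding lin_span_def by blast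
  then have "q p * ?w p = (\<Sum>n<N. c n * tri_basis e n p)" for p by meson
  then have "(L2_norm T (\<lambda>p. f p - (\<Sum>n<N. c n * tri_basis e n p)))\<^sup>2 < d"
    using fq by simp
  then show ?thesis by blast
qed

subsection \<open>Integration over the triangle by reflection\<close>

text \<open>The change of variables rule \<open>has_integral_twiddle\<close> concerns boxes, so
  \<open>f\<close> is extended by zero to a box around \<open>T\<close>. As \<open>g\<close> is an
  involution that maps boxes to boxes of equal content, it is its own inverse and the scaling factor
  is 1.\<close>

lemma has_integral_T_reflect:
  fixes f :: "real \<times> real \<Rightarrow> real"
  assumes g: "\<And>p. g (g p) = p" "continuous_on UNIV g"
    and box: "\<And>a b c d. g ` cbox (a, b) (c, d) = cbox (\<alpha> a b c d) (\<beta> a b c d)"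
    and content: "\<And>a b c d. measure lborel (cbox (\<alpha> a b c d) (\<beta> a b c d)) = measure lborel (cbox (a, b) (c, d))"
    and f: "(f has_integral i) T"
  shows "((\<lambda>p. f (g p)) has_integral i) (g ` T)"
proof -
  let ?f = "\<lambda>p. if p \<in> T then f p else 0"
  obtain a where a: "T \<subseteq> cbox (-a) a"
    using compact_imp_bounded[OF compact_T] bounded_subset_cbox_symmetric by blast
  have "(?f has_integral i) (cbox (-a) a)"
    using f has_integral_restrict[OF a] by blast
  then have "((\<lambda>p. ?f (g p)) has_integral (1 / 1) *\<^sub>R i) (g ` cbox (-a) a)"
  proof (rule has_integral_twiddle[rotated -1])
    show "isCont g p" for p using g(2) continuous_on_eq_continuous_at[OF open_UNIV] by blast
    show "\<exists>w z. g ` cbox u v = cbox w z" for u v using box by (cases u; cases v) blast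
    then show "\<exists>w z. g ` cbox u v = cbox w z" for u v .
    show "measure lborel (g ` cbox u v) =
        1 * measure lborel (cbox u v)" for u v
      using box content by (cases u; cases v) simp
  qed (use g in auto)
  moreover have "(\<lambda>p. ?f (g p)) = (\<lambda>p. if p \<in> g ` T then f (g p) else 0)"
    using g(1) by (metis image_eqI imageE)
  moreover have "g ` T \<subseteq> g ` cbox (-a) a" using a by blast
  ultimately show ?thesis
    using has_integral_restrict by fastforce
qed

lemma has_integral_T_swap:
  fixes f :: "real \<times> real \<Rightarrow> real"
  assumes "(f has_integral i) T"
  shows "((\<lambda>p. f (snd p, fst p)) has_integral i) T"
proof -
  have img: "(\<lambda>p. (snd p, fst p)) ` S = {p. (snd p, fst p) \<in> S}" for S :: "(real \<times> real) set"
    by force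
  have "((\<lambda>p. f (snd p, fst p)) has_integral i) ((\<lambda>p. (snd p, fst p)) ` T)"
  proof (rule has_integral_T_reflect[OF _ _ _ _ assms])
    show "(\<lambda>p. (snd p, fst p)) ` cbox (a, b) (c, d) = cbox (b, a) (d, c)" for a b c d :: real
      unfolding img by (auto simp: cbox_Pair_eq)
    show "measure lborel (cbox (b, a) (d, c)) = measure lborel (cbox (a, b) (c, d))" for a b c d :: real
      by (simp add: content_Pair)
  qed (auto intro!: continuous_intros)
  moreover have "(\<lambda>p. (snd p, fst p)) ` T = T"
    unfolding img by (auto simp: T_def)
  ultimately show ?thesis by simp
qed

lemma has_integral_T_reflect_hypotenuse:
  fixes f :: "real \<times> real \<Rightarrow> real"
  assumes "(f has_integral i) T"
  shows "((\<lambda>p. f (1 - snd p, 1 - fst p)) has_integral i)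
    {(x, y). x \<le> 1 \<and> y \<le> 1 \<and> 1 \<le> x + y}"
proof -
  have img: "(\<lambda>p. (1 - snd p, 1 - fst p)) ` S = {p. (1 - snd p, 1 - fst p) \<in> S}"
    for S :: "(real \<times> real) set"
    by force
  have "((\<lambda>p. f (1 - snd p, 1 - fst p)) has_integral i) ((\<lambda>p. (1 - snd p, 1 - fst p)) ` T)"
  proof (rule has_integral_T_reflect[OF _ _ _ _ assms])
    show "(\<lambda>p. (1 - snd p, 1 - fst p)) ` cbox (a, b) (c, d) = cbox (1 - d, 1 - c) (1 - b, 1 - a)"
      for a b c d :: real
      unfolding img by (auto simp: cbox_Pair_eq)
    show "measure lborel (cbox (1 - d, 1 - c) (1 - b, 1 - a)) = measure lborel (cbox (a, b) (c, d))"
      for a b c d :: real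
      by (simp add: content_Pair)
  qed (auto intro!: continuous_intros)
  moreover have "(\<lambda>p. (1 - snd p, 1 - fst p)) ` T = {(x, y). x \<le> 1 \<and> y \<le> 1 \<and> 1 \<le> x + y}"
    unfolding img by (auto simp: T_def)
  ultimately show ?thesis by simp
qed

text \<open>The unit square is the union of \<open>T\<close> and its mirror image in the hypotenuse,
  and these overlap only in a segment of the line x + y = 1.\<close>

lemma integral_square_eq_triangles:
  fixes f :: "real \<times> real \<Rightarrow> real"
  assumes f: "continuous_on UNIV f"
  shows "integral (cbox (0, 0) (1, 1)) f =
    (LINT p|lebesgue_on T. f p) + (LINT p|lebesgue_on T. f (1 - snd p, 1 - fst p))"
proof -
  let ?r = "\<lambda>p :: real \<times> real. (1 - snd p, 1 - fst p)"
  let ?T' = "{(x, y). x \<le> 1 \<and> y \<le> 1 \<and> 1 \<le> x + y} :: (real \<times> real) set"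
  have hi: "(g has_integral (LINT p|lebesgue_on T. g p)) T" if "continuous_on UNIV g"
    for g :: "real \<times> real \<Rightarrow> real"
    using continuous_imp_integrable_T[OF continuous_on_subset[OF that]]
    by (intro has_integral_integral_lebesgue_on) simp_all
  have "continuous_on UNIV (\<lambda>p. f (?r p))"
    by (rule continuous_on_compose2[OF f]) (auto intro!: continuous_intros)
  from has_integral_T_reflect_hypotenuse[OF hi[OF this]]
  have "(f has_integral (LINT p|lebesgue_on T. f (?r p))) ?T'" by simp
  moreover have "negligible (T \<inter> ?T')"
  proof (rule negligible_subset)
    show "negligible {p. (1, 1) \<bullet> p = (1 :: real)}"
      by (intro negligible_hyperplane) (auto simp: zero_prod_def)
  qed (auto simp: T_def)
  ultimately have "(f has_integral
      (LINT p|lebesgue_on T. f p) + (LINT p|lebesgue_on T. f (?r p))) (T \<union> ?T')"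
    by (intro has_integral_Un hi f)
  moreover have "T \<union> ?T' = cbox (0, 0) (1, 1)"
    by (auto simp: T_def cbox_Pair_eq)
  ultimately show ?thesis by (simp add: integral_unique)
qed

lemma LINT_T_swap:
  fixes f :: "real \<times> real \<Rightarrow> real"
  assumes f: "continuous_on T f"
  shows "(LINT p|lebesgue_on T. f (snd p, fst p)) = (LINT p|lebesgue_on T. f p)"
proof -
  have "continuous_on T (\<lambda>p. f (snd p, fst p))"
    by (rule continuous_on_compose2[OF f]) (auto simp: T_def intro!: continuous_intros)
  from has_integral_integral_lebesgue_on[OF continuous_imp_integrable_T[OF this] T_lebesgue]
    has_integral_T_swap[OF has_integral_integral_lebesgue_on[OF continuous_imp_integrable_T[OF f] T_lebesgue]]
  show ?thesis by (rule has_integral_unique)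
qed

lemma integral_square_product:
  fixes f g :: "real \<Rightarrow> real"
  assumes "continuous_on UNIV f" "continuous_on UNIV g"
  shows "integral (cbox (0, 0) (1, 1)) (\<lambda>p. f (fst p) * g (snd p)) =
    integral {0..1} f * integral {0..1} g"
proof -
  have "continuous_on (cbox (0, 0) (1, 1)) (\<lambda>p :: real \<times> real. f (fst p) * g (snd p))"
    by (intro continuous_on_mult continuous_on_compose2[OF assms(1)] continuous_on_compose2[OF assms(2)]
        continuous_intros) auto
  from integral_prod_continuous[OF this] show ?thesis by simp
qed

subsection \<open>Orthogonality\<close>

lemma has_integral_cos_pi:
  assumes "a \<le> b" "k \<noteq> 0"
  shows "(cos_pi k has_integral (sin_pi k b - sin_pi k a) / (of_int k * pi)) {a..b}"
proof -
  have "(cos_pi k has_integral sin_pi k b / (of_int k * pi) - sin_pi k a / (of_int k * pi)) {a..b}"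
  proof (rule fundamental_theorem_of_calculus[OF assms(1)])
    fix x assume "x \<in> {a..b}"
    show "((\<lambda>x. sin_pi k x / (of_int k * pi)) has_vector_derivative cos_pi k x) (at x within {a..b})"
      unfolding has_real_derivative_iff_has_vector_derivative[symmetric] sin_pi_def cos_pi_def
      using assms(2) by (auto intro!: derivative_eq_intros)
  qed
  then show ?thesis by (simp add: diff_divide_distrib)
qed

lemma sin_pi_mult: "sin_pi m x * sin_pi n x = (cos_pi (m - n) x - cos_pi (m + n) x) / 2"
  by (simp add: sin_pi_def cos_pi_def left_diff_distrib distrib_right cos_add cos_diff)

lemma cos_pi_mult: "cos_pi m x * cos_pi n x = (cos_pi (m - n) x + cos_pi (m + n) x) / 2"
  by (simp add: cos_pi_def left_diff_distrib distrib_right cos_add cos_diff)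

lemma sin_pi_int: "sin_pi k 0 = 0" "sin_pi k 1 = 0"
  by (simp_all add: sin_pi_def sin_integer_2pi mult.commute)

lemma integral_cos_pi_unit: "(cos_pi k has_integral (if k = 0 then 1 else 0)) {0..1}"
proof (cases "k = 0")
  case True
  then have "cos_pi k = (\<lambda>_. 1)" by (simp add: cos_pi_def fun_eq_iff)
  then show ?thesis using True has_integral_const_real[of 1 0 1] by simp
next
  case False
  then show ?thesis using has_integral_cos_pi[of 0 1 k] by (simp add: sin_pi_int)
qed

lemma integral_sin_pi_mult:
  assumes "0 < m" "0 < n"
  shows "integral {0..1} (\<lambda>x. sin_pi m x * sin_pi n x) = (if m = n then 1 / 2 else 0)"
proof -
  have "((\<lambda>x. sin_pi m x * sin_pi n x) has_integral
      ((if m - n = 0 then 1 else 0) - (if m + n = 0 then 1 else 0)) / 2) {0..1}"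
    unfolding sin_pi_mult
    by (intro has_integral_divide has_integral_diff integral_cos_pi_unit)
  then show ?thesis using assms by (auto simp: integral_unique)
qed

lemma integral_cos_pi_mult:
  assumes "0 < m" "0 < n"
  shows "integral {0..1} (\<lambda>x. cos_pi m x * cos_pi n x) = (if m = n then 1 / 2 else 0)"
proof -
  have "((\<lambda>x. cos_pi m x * cos_pi n x) has_integral
      ((if m - n = 0 then 1 else 0) + (if m + n = 0 then 1 else 0)) / 2) {0..1}"
    unfolding cos_pi_mult
    by (intro has_integral_divide has_integral_add integral_cos_pi_unit)
  then show ?thesis using assms by (auto simp: integral_unique)
qed

text \<open>Each of the four products separates by Fubini. The factors are left general so that the
  formula applies both to products of modes and to squares of their derivatives.\<close>

lemma integral_square_bilinear:
  fixes a b c d a' b' c' d' :: "real \<Rightarrow> real"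
  assumes [continuous_intros]: "continuous_on UNIV a" "continuous_on UNIV b" "continuous_on UNIV c" "continuous_on UNIV d"
    "continuous_on UNIV a'" "continuous_on UNIV b'" "continuous_on UNIV c'" "continuous_on UNIV d'"
  shows "integral (cbox (0, 0) (1, 1)) (\<lambda>p.
      (r * (a (fst p) * b (snd p)) - s * (c (fst p) * d (snd p))) *
      (r' * (a' (fst p) * b' (snd p)) - s' * (c' (fst p) * d' (snd p)))) =
    r * r' * (integral {0..1} (\<lambda>x. a x * a' x) * integral {0..1} (\<lambda>x. b x * b' x)) -
    r * s' * (integral {0..1} (\<lambda>x. a x * c' x) * integral {0..1} (\<lambda>x. b x * d' x)) -
    s * r' * (integral {0..1} (\<lambda>x. c x * a' x) * integral {0..1} (\<lambda>x. d x * b' x)) +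
    s * s' * (integral {0..1} (\<lambda>x. c x * c' x) * integral {0..1} (\<lambda>x. d x * d' x))"
proof -
  have prod: "((\<lambda>p. (f (fst p) * f' (fst p)) * (g (snd p) * g' (snd p))) has_integral
      integral {0..1} (\<lambda>x. f x * f' x) * integral {0..1} (\<lambda>x. g x * g' x)) (cbox (0, 0) (1, 1))"
    if c: "continuous_on UNIV f" "continuous_on UNIV f'" "continuous_on UNIV g" "continuous_on UNIV g'"
    for f f' g g' :: "real \<Rightarrow> real"
  proof -
    have *: "continuous_on (cbox (0, 0) (1, 1)) (\<lambda>p :: real \<times> real. f (fst p) * f' (fst p) * (g (snd p) * g' (snd p)))"
      by (intro continuous_on_mult continuous_on_compose2[OF c(1)] continuous_on_compose2[OF c(2)]
          continuous_on_compose2[OF c(3)] continuous_on_compose2[OF c(4)] continuous_intros) auto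
    have "continuous_on UNIV (\<lambda>x. f x * f' x)" "continuous_on UNIV (\<lambda>x. g x * g' x)"
      using c by (auto intro: continuous_on_mult)
    from integral_square_product[OF this] integrable_integral[OF integrable_continuous[OF *]]
    show ?thesis by simp
  qed
  have "(\<lambda>p. (r * (a (fst p) * b (snd p)) - s * (c (fst p) * d (snd p))) *
      (r' * (a' (fst p) * b' (snd p)) - s' * (c' (fst p) * d' (snd p)))) =
    (\<lambda>p. r * r' * ((a (fst p) * a' (fst p)) * (b (snd p) * b' (snd p))) -
      r * s' * ((a (fst p) * c' (fst p)) * (b (snd p) * d' (snd p))) -
      s * r' * ((c (fst p) * a' (fst p)) * (d (snd p) * b' (snd p))) +
      s * s' * ((c (fst p) * c' (fst p)) * (d (snd p) * d' (snd p))))"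
    by (intro ext) (simp add: algebra_simps)
  then show ?thesis
    by (simp only:) (intro integral_unique has_integral_add has_integral_diff has_integral_mult_right prod assms)
qed

lemma cos_int_mult_pi: "cos (of_int k * pi) = (if even k then 1 else -1)"
proof (cases "even k")
  case True
  then obtain j where "k = 2 * j" by blast
  then show ?thesis using cos_int_2pin[of j] by (simp add: mult_ac)
next
  case False
  then obtain j where j: "k = 2 * j + 1" by (rule oddE)
  have "cos (of_int k * pi) = cos (2 * pi * of_int j + pi)" by (simp add: j algebra_simps)
  then show ?thesis using False cos_int_2pin[of j] by simp
qed

lemma sin_pi_reflect: "sin_pi k (1 - x) = (if even k then - sin_pi k x else sin_pi k x)"
proof -
  have "sin (of_int k * pi) = 0" using sin_pi_int(2)[of k] by (simp add: sin_pi_def)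
  then show ?thesis by (simp add: sin_pi_def right_diff_distrib sin_diff cos_int_mult_pi)
qed

lemma cos_pi_reflect: "cos_pi k (1 - x) = (if even k then cos_pi k x else - cos_pi k x)"
proof -
  have "sin (of_int k * pi) = 0" using sin_pi_int(2)[of k] by (simp add: sin_pi_def)
  then show ?thesis by (simp add: cos_pi_def right_diff_distrib cos_diff cos_int_mult_pi)
qed

lemma tri_mode_reflect: "tri_mode m n (1 - snd p, 1 - fst p) = - tri_mode m n p"
  by (simp add: tri_mode_def sin_pi_reflect parity_sign_def)

text \<open>The product of two odd functions is invariant under the reflection, so the integral over
  \<open>T\<close> is half of that over the square. There the mixed terms would require
  \<open>m = l\<close> and \<open>n = k\<close>, which contradicts the ordering of the indices; for
  equal pairs the other two terms give 1/4 each.\<close>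

lemma tri_mode_orthogonal:
  assumes "0 < n" "n < m" "0 < l" "l < k"
  shows "(LINT p|lebesgue_on T. tri_mode m n p * tri_mode k l p) = (if m = k \<and> n = l then 1 / 4 else 0)"
proof -
  have c: "continuous_on UNIV (sin_pi j)" for j
    using continuous_on_sin_pi[OF continuous_on_id] by simp
  have "integral (cbox (0, 0) (1, 1)) (\<lambda>p. tri_mode m n p * tri_mode k l p) =
      integral (cbox (0, 0) (1, 1)) (\<lambda>p.
      (1 * (sin_pi m (fst p) * sin_pi n (snd p)) - parity_sign m n * (sin_pi n (fst p) * sin_pi m (snd p))) *
      (1 * (sin_pi k (fst p) * sin_pi l (snd p)) - parity_sign k l * (sin_pi l (fst p) * sin_pi k (snd p))))"
    by (simp add: tri_mode_def)
  also have "\<dots> = (if m = k \<and> n = l then 1 / 2 else 0)"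
    unfolding integral_square_bilinear[OF c c c c c c c c]
    using assms by (auto simp: integral_sin_pi_mult parity_sign_square)
  finally have I: "integral (cbox (0, 0) (1, 1)) (\<lambda>p. tri_mode m n p * tri_mode k l p) =
      (if m = k \<and> n = l then 1 / 2 else 0)" .
  have "(LINT p|lebesgue_on T. tri_mode m n p * tri_mode k l p) =
      integral (cbox (0, 0) (1, 1)) (\<lambda>p. tri_mode m n p * tri_mode k l p) / 2"
    using integral_square_eq_triangles[of "\<lambda>p. tri_mode m n p * tri_mode k l p"]
    by (simp add: tri_mode_reflect continuous_on_mult continuous_on_tri_mode)
  then show ?thesis unfolding I by (cases "m = k \<and> n = l") simp_all
qed

subsection \<open>Eigenfunctions and their gradients\<close>

definition tri_dx :: "int \<Rightarrow> int \<Rightarrow> real \<times> real \<Rightarrow> real" where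
  "tri_dx m n p = pi * (of_int m * (cos_pi m (fst p) * sin_pi n (snd p)) -
     parity_sign m n * of_int n * (cos_pi n (fst p) * sin_pi m (snd p)))"

definition tri_dy :: "int \<Rightarrow> int \<Rightarrow> real \<times> real \<Rightarrow> real" where
  "tri_dy m n p = pi * (of_int n * (sin_pi m (fst p) * cos_pi n (snd p)) -
     parity_sign m n * of_int m * (sin_pi n (fst p) * cos_pi m (snd p)))"

definition tri_dxx :: "int \<Rightarrow> int \<Rightarrow> real \<times> real \<Rightarrow> real" where
  "tri_dxx m n p = - (pi\<^sup>2) * ((of_int m)\<^sup>2 * (sin_pi m (fst p) * sin_pi n (snd p)) -
     parity_sign m n * (of_int n)\<^sup>2 * (sin_pi n (fst p) * sin_pi m (snd p)))"

definition tri_dxy :: "int \<Rightarrow> int \<Rightarrow> real \<times> real \<Rightarrow> real" where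
  "tri_dxy m n p = pi\<^sup>2 * of_int m * of_int n * (cos_pi m (fst p) * cos_pi n (snd p) -
     parity_sign m n * (cos_pi n (fst p) * cos_pi m (snd p)))"

definition tri_dyy :: "int \<Rightarrow> int \<Rightarrow> real \<times> real \<Rightarrow> real" where
  "tri_dyy m n p = - (pi\<^sup>2) * ((of_int n)\<^sup>2 * (sin_pi m (fst p) * sin_pi n (snd p)) -
     parity_sign m n * (of_int m)\<^sup>2 * (sin_pi n (fst p) * sin_pi m (snd p)))"

lemma continuous_on_tri_derivs:
  "continuous_on S (tri_dx m n)" "continuous_on S (tri_dy m n)" "continuous_on S (tri_dxx m n)"
  "continuous_on S (tri_dxy m n)" "continuous_on S (tri_dyy m n)"
  unfolding tri_dx_def tri_dy_def tri_dxx_def tri_dxy_def tri_dyy_def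
  by (intro continuous_intros)+

lemma has_derivative_product_mode:
  fixes p :: "real \<times> real"
  assumes "(A has_real_derivative A') (at (fst p))" "(B has_real_derivative B') (at (snd p))"
  shows "((\<lambda>p. A (fst p) * B (snd p)) has_derivative
    (\<lambda>v. fst v * (A' * B (snd p)) + snd v * (A (fst p) * B'))) (at p)"
proof -
  have 1: "((\<lambda>p. A (fst p)) has_derivative (\<lambda>v. fst v * A')) (at p)"
    using has_derivative_compose[OF bounded_linear_imp_has_derivative[OF bounded_linear_fst]
        assms(1)[unfolded has_field_derivative_def]] by (simp add: mult.commute)
  have 2: "((\<lambda>p. B (snd p)) has_derivative (\<lambda>v. snd v * B')) (at p)"
    using has_derivative_compose[OF bounded_linear_imp_has_derivative[OF bounded_linear_snd]
        assms(2)[unfolded has_field_derivative_def]] by (simp add: mult.commute)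
  show ?thesis
    by (rule has_derivative_eq_rhs[OF has_derivative_mult[OF 1 2]]) (auto simp: algebra_simps)
qed

lemma has_real_derivative_sin_pi:
  "(sin_pi k has_real_derivative of_int k * pi * cos_pi k x) (at x)"
  unfolding sin_pi_def cos_pi_def by (auto intro!: derivative_eq_intros)

lemma has_real_derivative_cos_pi:
  "(cos_pi k has_real_derivative - of_int k * pi * sin_pi k x) (at x)"
  unfolding sin_pi_def cos_pi_def by (auto intro!: derivative_eq_intros)

lemma has_derivative_tri_mode:
  "(tri_mode m n has_derivative (\<lambda>v. fst v * tri_dx m n p + snd v * tri_dy m n p)) (at p)"
  unfolding tri_mode_def[abs_def] tri_dx_def tri_dy_def
  by (rule has_derivative_eq_rhs[OF has_derivative_diff
    [OF has_derivative_product_mode[OF has_real_derivative_sin_pi[of m] has_real_derivative_sin_pi[of n]]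
      has_derivative_mult_right[OF has_derivative_product_mode[OF has_real_derivative_sin_pi[of n] has_real_derivative_sin_pi[of m]]]]])
    (simp add: fun_eq_iff algebra_simps power2_eq_square)

lemma has_derivative_tri_dx:
  "(tri_dx m n has_derivative (\<lambda>v. fst v * tri_dxx m n p + snd v * tri_dxy m n p)) (at p)"
  unfolding tri_dx_def[abs_def] tri_dxx_def tri_dxy_def
  by (rule has_derivative_eq_rhs[OF has_derivative_mult_right[OF has_derivative_diff
    [OF has_derivative_mult_right[OF has_derivative_product_mode[OF has_real_derivative_cos_pi[of m] has_real_derivative_sin_pi[of n]]]
      has_derivative_mult_right[OF has_derivative_product_mode[OF has_real_derivative_cos_pi[of n] has_real_derivative_sin_pi[of m]]]]]])
    (simp add: fun_eq_iff algebra_simps power2_eq_square)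

lemma has_derivative_tri_dy:
  "(tri_dy m n has_derivative (\<lambda>v. fst v * tri_dxy m n p + snd v * tri_dyy m n p)) (at p)"
  unfolding tri_dy_def[abs_def] tri_dxy_def tri_dyy_def
  by (rule has_derivative_eq_rhs[OF has_derivative_mult_right[OF has_derivative_diff
    [OF has_derivative_mult_right[OF has_derivative_product_mode[OF has_real_derivative_sin_pi[of m] has_real_derivative_cos_pi[of n]]]
      has_derivative_mult_right[OF has_derivative_product_mode[OF has_real_derivative_sin_pi[of n] has_real_derivative_cos_pi[of m]]]]]])
    (simp add: fun_eq_iff algebra_simps power2_eq_square)

text \<open>The equation for \<open>f\<close> is assumed on \<open>T\<close> only, because first
  derivatives within \<open>T\<close> are known explicitly only there and have to be differentiated
  again.\<close>

lemma dir_deriv_on_T: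
  assumes eq: "\<And>p. p \<in> T \<Longrightarrow> f p = c * g p"
    and der: "\<And>p. (g has_derivative (\<lambda>v. fst v * a p + snd v * b p)) (at p)"
  shows "f differentiable_on T" "p \<in> T \<Longrightarrow> dir_deriv v f p = c * (fst v * a p + snd v * b p)"
proof -
  have *: "(f has_derivative (\<lambda>v. c * (fst v * a p + snd v * b p))) (at p within T)" if "p \<in> T" for p
    using has_derivative_transform[OF that eq has_derivative_mult_right[OF has_derivative_at_withinI[OF der]]]
    by blast
  show "f differentiable_on T"
    using * unfolding differentiable_on_def differentiable_def by blast
  show "dir_deriv v f p = c * (fst v * a p + snd v * b p)" if "p \<in> T"
    using dir_deriv_eqI[OF that *[OF that]] by simp
qed

context
  fixes m n :: int and u :: "real \<times> real \<Rightarrow> real"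
  defines "u \<equiv> \<lambda>p. 2 * tri_mode m n p"
begin

lemma dir_deriv_mode: "p \<in> T \<Longrightarrow> dir_deriv v u p = 2 * (fst v * tri_dx m n p + snd v * tri_dy m n p)"
  and differentiable_mode: "u differentiable_on T"
  using dir_deriv_on_T[OF _ has_derivative_tri_mode, of u 2 m n] by (auto simp: u_def)

lemma dx_mode: "p \<in> T \<Longrightarrow> dx u p = 2 * tri_dx m n p"
  and dy_mode: "p \<in> T \<Longrightarrow> dy u p = 2 * tri_dy m n p"
  by (simp_all add: dir_deriv_mode)

lemma second_dir_deriv_mode:
  assumes "p \<in> T"
  shows "dir_deriv v (dx u) p = 2 * (fst v * tri_dxx m n p + snd v * tri_dxy m n p)"
    and "dir_deriv v (dy u) p = 2 * (fst v * tri_dxy m n p + snd v * tri_dyy m n p)"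
  using dir_deriv_on_T(2)[OF dx_mode has_derivative_tri_dx assms]
    dir_deriv_on_T(2)[OF dy_mode has_derivative_tri_dy assms] by auto

lemma C2_on_T_mode: "C2_on_T u"
proof -
  have "continuous_on T (dir_deriv v (dx u))" "continuous_on T (dir_deriv v (dy u))" for v
    by (subst continuous_on_cong[OF refl second_dir_deriv_mode(1)]
        continuous_on_cong[OF refl second_dir_deriv_mode(2)], assumption,
        intro continuous_intros continuous_on_tri_derivs)+
  then show ?thesis
    using differentiable_mode dir_deriv_on_T(1)[OF dx_mode has_derivative_tri_dx]
      dir_deriv_on_T(1)[OF dy_mode has_derivative_tri_dy]
    by (simp add: C2_on_T_def)
qed

lemma laplacian_mode:
  assumes "p \<in> T"
  shows "laplacian u p = - (pi\<^sup>2 * ((of_int m)\<^sup>2 + (of_int n)\<^sup>2)) * u p"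
proof -
  have "laplacian u p = 2 * (tri_dxx m n p + tri_dyy m n p)"
    using second_dir_deriv_mode[OF assms] by (simp add: laplacian_def)
  also have "\<dots> = - (pi\<^sup>2 * ((of_int m)\<^sup>2 + (of_int n)\<^sup>2)) * u p"
    by (simp add: tri_dxx_def tri_dyy_def u_def tri_mode_def algebra_simps)
  finally show ?thesis .
qed

text \<open>On the legs a sine factor vanishes in each term. On the hypotenuse y = 1 - x, and
  \<open>parity_sign\<close> is exactly the sign that makes the two terms cancel.\<close>

lemma mode_zero_on_frontier:
  assumes "p \<in> frontier T"
  shows "u p = 0"
proof -
  obtain x y where p: "p = (x, y)" by (cases p)
  have "x = 0 \<or> y = 0 \<or> y = 1 - x"
    using assms frontier_T by (force simp: p)
  then show ?thesis
    by (auto simp: u_def p tri_mode_def sin_pi_int sin_pi_reflect parity_sign_def)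
qed

end

section \<open>Eigenvalues, normalisation and gradient norms\<close>

definition wavelength :: "int \<Rightarrow> int \<Rightarrow> real" where
  "wavelength m n = 1 / (pi * sqrt ((of_int m)\<^sup>2 + (of_int n)\<^sup>2))"

lemma wavelength_square: "(wavelength m n)\<^sup>2 = 1 / (pi\<^sup>2 * ((of_int m)\<^sup>2 + (of_int n)\<^sup>2))"
  by (simp add: wavelength_def power_divide power_mult_distrib)

lemma dirichlet_eigenfunction_mode:
  assumes "0 < n" "n < m"
  shows "dirichlet_eigenfunction (wavelength m n) (\<lambda>p. 2 * tri_mode m n p)"
proof -
  have pos: "(of_int m)\<^sup>2 + (of_int n)\<^sup>2 > (0 :: real)" using assms by (simp add: sum_power2_gt_zero_iff)
  have "wavelength m n > 0" using pos by (simp add: wavelength_def)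
  moreover have "- ((wavelength m n)\<^sup>2) * laplacian (\<lambda>p. 2 * tri_mode m n p) p = 2 * tri_mode m n p"
    if "p \<in> T" for p
    using pos assms by (simp add: laplacian_mode[OF that] wavelength_square)
  moreover have "L2_norm T (\<lambda>p. 2 * tri_mode m n p) = 1"
    using tri_mode_orthogonal[of n m n m] assms
    by (simp add: L2_norm_def power_mult_distrib power2_eq_square)
  ultimately show ?thesis
    using C2_on_T_mode mode_zero_on_frontier by (simp add: dirichlet_eigenfunction_def)
qed

lemma tri_dx_swap: "(tri_dx m n (snd p, fst p))\<^sup>2 = (tri_dy m n p)\<^sup>2"
proof -
  have "tri_dx m n (snd p, fst p) = - parity_sign m n * tri_dy m n p"
    by (simp add: tri_dx_def tri_dy_def parity_sign_def algebra_simps)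
  then show ?thesis by (simp add: power_mult_distrib power2_eq_square[of "parity_sign m n"] parity_sign_square)
qed

text \<open>This is the derivative in y of the oddness relation
  \<open>tri_mode_reflect\<close>.\<close>

lemma tri_dx_reflect: "tri_dx m n (1 - snd p, 1 - fst p) = tri_dy m n p"
  by (simp add: tri_dx_def tri_dy_def cos_pi_reflect sin_pi_reflect parity_sign_def algebra_simps)

text \<open>Swapping the coordinates shows that the two integrals agree. By the reflection in the
  hypotenuse their sum is the integral of \<open>(tri_dx m n p)\<^sup>2\<close> over the square,
  where the mixed terms vanish because \<open>m\<close> and \<open>n\<close> differ.\<close>

lemma integral_tri_dx_square:
  assumes "0 < n" "n < m"
  shows "(LINT p|lebesgue_on T. (tri_dx m n p)\<^sup>2) = pi\<^sup>2 * ((of_int m)\<^sup>2 + (of_int n)\<^sup>2) / 8"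
    and "(LINT p|lebesgue_on T. (tri_dy m n p)\<^sup>2) = pi\<^sup>2 * ((of_int m)\<^sup>2 + (of_int n)\<^sup>2) / 8"
proof -
  let ?I = "LINT p|lebesgue_on T. (tri_dx m n p)\<^sup>2" and ?J = "LINT p|lebesgue_on T. (tri_dy m n p)\<^sup>2"
  have c: "continuous_on UNIV (sin_pi j)" "continuous_on UNIV (cos_pi j)" for j
    using continuous_on_sin_pi[OF continuous_on_id] continuous_on_cos_pi[OF continuous_on_id] by simp_all
  have "?I = ?J"
    using LINT_T_swap[of "\<lambda>p. (tri_dx m n p)\<^sup>2"]
    by (simp add: tri_dx_swap continuous_on_power continuous_on_tri_derivs)
  have "integral (cbox (0, 0) (1, 1)) (\<lambda>p. (tri_dx m n p)\<^sup>2) =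
    integral (cbox (0, 0) (1, 1)) (\<lambda>p.
      (pi * of_int m * (cos_pi m (fst p) * sin_pi n (snd p)) -
       pi * parity_sign m n * of_int n * (cos_pi n (fst p) * sin_pi m (snd p))) *
      (pi * of_int m * (cos_pi m (fst p) * sin_pi n (snd p)) -
       pi * parity_sign m n * of_int n * (cos_pi n (fst p) * sin_pi m (snd p))))"
    by (simp add: tri_dx_def power2_eq_square right_diff_distrib mult.assoc)
  also have "\<dots> = pi\<^sup>2 * ((of_int m)\<^sup>2 + (of_int n)\<^sup>2) / 4"
    unfolding integral_square_bilinear[OF c(2,1,2,1,2,1,2,1)]
    using assms by (simp add: integral_sin_pi_mult integral_cos_pi_mult parity_sign_def
        power2_eq_square algebra_simps)
  finally have "integral (cbox (0, 0) (1, 1)) (\<lambda>p. (tri_dx m n p)\<^sup>2) =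
    pi\<^sup>2 * ((of_int m)\<^sup>2 + (of_int n)\<^sup>2) / 4" .
  then have "?I + ?J = pi\<^sup>2 * ((of_int m)\<^sup>2 + (of_int n)\<^sup>2) / 4"
    using integral_square_eq_triangles[of "\<lambda>p. (tri_dx m n p)\<^sup>2"]
    by (simp add: tri_dx_reflect continuous_on_power continuous_on_tri_derivs)
  with \<open>?I = ?J\<close> show "?I = pi\<^sup>2 * ((of_int m)\<^sup>2 + (of_int n)\<^sup>2) / 8"
    and "?J = pi\<^sup>2 * ((of_int m)\<^sup>2 + (of_int n)\<^sup>2) / 8"
    by simp_all
qed

lemma L2_norm_gradient_mode:
  assumes "0 < n" "n < m"
  shows "(L2_norm T (\<lambda>p. wavelength m n * dx (\<lambda>p. 2 * tri_mode m n p) p))\<^sup>2 = 1 / 2"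
    and "(L2_norm T (\<lambda>p. wavelength m n * dy (\<lambda>p. 2 * tri_mode m n p) p))\<^sup>2 = 1 / 2"
proof -
  have pos: "(of_int m)\<^sup>2 + (of_int n)\<^sup>2 > (0 :: real)" using assms by (simp add: sum_power2_gt_zero_iff)
  have norm: "(L2_norm T (\<lambda>p. wavelength m n * f p))\<^sup>2 = 1 / 2"
    if "\<And>p. p \<in> T \<Longrightarrow> f p = 2 * g p"
      and "(LINT p|lebesgue_on T. (g p)\<^sup>2) = pi\<^sup>2 * ((of_int m)\<^sup>2 + (of_int n)\<^sup>2) / 8" for f g
  proof -
    have "(L2_norm T (\<lambda>p. wavelength m n * f p))\<^sup>2 = (LINT p|lebesgue_on T. (wavelength m n * f p)\<^sup>2)"
      by (simp add: L2_norm_def)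
    also have "\<dots> = (LINT p|lebesgue_on T. 4 * (wavelength m n)\<^sup>2 * (g p)\<^sup>2)"
      by (rule Bochner_Integration.integral_cong) (simp_all add: that(1) power_mult_distrib)
    also have "\<dots> = 1 / 2" using pos by (simp add: that(2) wavelength_square)
    finally show ?thesis .
  qed
  show "(L2_norm T (\<lambda>p. wavelength m n * dx (\<lambda>p. 2 * tri_mode m n p) p))\<^sup>2 = 1 / 2"
    by (rule norm[OF dx_mode integral_tri_dx_square(1)[OF assms]])
  show "(L2_norm T (\<lambda>p. wavelength m n * dy (\<lambda>p. 2 * tri_mode m n p) p))\<^sup>2 = 1 / 2"
    by (rule norm[OF dy_mode integral_tri_dx_square(2)[OF assms]])
qed

subsection \<open>Neumann data on the two half sides\<close>

lemma sin_pi_double_half: "sin_pi (2 * k) (1 / 2) = 0"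
  using sin_pi_int(2)[of k] by (simp add: sin_pi_def)

text \<open>The primitive of the oscillating part is a multiple of \<open>sin_pi (2 * k)\<close>,
  which vanishes at 0, 1/2 and 1.\<close>

lemma has_integral_sin_pi_square_half:
  assumes "0 < k"
  shows "((\<lambda>x. (sin_pi k x)\<^sup>2) has_integral 1 / 4) {0..1/2}"
    and "((\<lambda>x. (sin_pi k x)\<^sup>2) has_integral 1 / 4) {1/2..1}"
proof -
  have eq: "(\<lambda>x. (sin_pi k x)\<^sup>2) = (\<lambda>x. (1 - cos_pi (2 * k) x) / 2)"
    using sin_pi_mult[of k _ k] by (simp add: fun_eq_iff power2_eq_square cos_pi_def)
  have "((\<lambda>x. (sin_pi k x)\<^sup>2) has_integral ((b - a) - (sin_pi (2 * k) b - sin_pi (2 * k) a) / (of_int (2 * k) * pi)) / 2) {a..b}"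
    if "a \<le> b" for a b
    unfolding eq
    using has_integral_const_real[of "1 :: real" a b] that assms
    by (intro has_integral_divide has_integral_diff has_integral_cos_pi) simp_all
  from this[of 0 "1 / 2"] this[of "1 / 2" 1]
  show "((\<lambda>x. (sin_pi k x)\<^sup>2) has_integral 1 / 4) {0..1/2}"
    and "((\<lambda>x. (sin_pi k x)\<^sup>2) has_integral 1 / 4) {1/2..1}"
    by (simp_all add: sin_pi_double_half sin_pi_int)
qed

text \<open>This is the integral of the product of two consecutive sines over the left half. Over
  the right half it changes sign, the two sines being orthogonal on the unit interval.\<close>

definition half_overlap :: "int \<Rightarrow> real" where
  "half_overlap n = (1 - sin_pi (2 * n + 1) (1 / 2) / of_int (2 * n + 1)) / (2 * pi)"

text \<open>Since the indices differ by 1, the product contains cos \<pi>x, whose integrals over the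
  two halves are 1/\<pi> and -1/\<pi> whatever \<open>n\<close> is; the other frequency
  \<open>2 * n + 1\<close> contributes only O(1/n).\<close>

lemma has_integral_sin_pi_consecutive_half:
  assumes "0 < n"
  shows "((\<lambda>x. sin_pi (n + 1) x * sin_pi n x) has_integral half_overlap n) {0..1/2}"
    and "((\<lambda>x. sin_pi (n + 1) x * sin_pi n x) has_integral - half_overlap n) {1/2..1}"
proof -
  have *: "((\<lambda>x. sin_pi (n + 1) x * sin_pi n x) has_integral
      ((sin_pi 1 b - sin_pi 1 a) / (of_int 1 * pi) -
       (sin_pi (2 * n + 1) b - sin_pi (2 * n + 1) a) / (of_int (2 * n + 1) * pi)) / 2) {a..b}"
    if "a \<le> b" for a b
  proof -
    have idx: "n + 1 - n = 1" "n + 1 + n = 2 * n + 1" by simp_all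
    show ?thesis
      unfolding sin_pi_mult idx using that assms
      by (intro has_integral_divide has_integral_diff has_integral_cos_pi) simp_all
  qed
  have "sin_pi 1 (1 / 2) = 1" by (simp add: sin_pi_def)
  with *[of 0 "1 / 2"] *[of "1 / 2" 1]
  show "((\<lambda>x. sin_pi (n + 1) x * sin_pi n x) has_integral half_overlap n) {0..1/2}"
    and "((\<lambda>x. sin_pi (n + 1) x * sin_pi n x) has_integral - half_overlap n) {1/2..1}"
    by (simp_all add: half_overlap_def sin_pi_int diff_divide_distrib mult_ac)
qed

definition overlap_weight :: "int \<Rightarrow> real" where
  "overlap_weight n = 8 * of_int n * (of_int n + 1) / ((of_int n + 1)\<^sup>2 + (of_int n)\<^sup>2)"

text \<open>Consecutive indices have \<open>parity_sign\<close> -1, so on the bottom side the two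
  sines add up with positive coefficients. Squaring produces the cross term, whose coefficient after
  scaling by the wavelength is \<open>overlap_weight n\<close>.\<close>

lemma neumann_density:
  assumes "0 < n" "0 \<le> x" "x \<le> 1"
  shows "\<bar>wavelength (n + 1) n * normal_deriv (\<lambda>p. 2 * tri_mode (n + 1) n p) (x, 0)\<bar>\<^sup>2 =
    (4 * (of_int n)\<^sup>2 * (sin_pi (n + 1) x)\<^sup>2 + 4 * (of_int n + 1)\<^sup>2 * (sin_pi n x)\<^sup>2)
      / ((of_int n + 1)\<^sup>2 + (of_int n)\<^sup>2) + overlap_weight n * (sin_pi (n + 1) x * sin_pi n x)"
proof -
  have "normal_deriv (\<lambda>p. 2 * tri_mode (n + 1) n p) (x, 0) = - (2 * tri_dy (n + 1) n (x, 0))"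
    using assms dir_deriv_mode[of "(x, 0)" "(0, -1)" "n + 1" n]
    by (simp add: normal_deriv_def outward_normal_def T_def)
  also have "\<dots> = - (2 * pi * (of_int n * sin_pi (n + 1) x + (of_int n + 1) * sin_pi n x))"
    by (simp add: tri_dy_def parity_sign_def cos_pi_def algebra_simps)
  finally have nd: "normal_deriv (\<lambda>p. 2 * tri_mode (n + 1) n p) (x, 0) =
    - (2 * pi * (of_int n * sin_pi (n + 1) x + (of_int n + 1) * sin_pi n x))" .
  have D: "(of_int n + 1)\<^sup>2 + (of_int n)\<^sup>2 > (0 :: real)"
    using assms by (simp add: sum_power2_gt_zero_iff)
  have expand: "1 / (pi\<^sup>2 * D) * (2 * pi * (p * a + q * b))\<^sup>2 =
      (4 * p\<^sup>2 * a\<^sup>2 + 4 * q\<^sup>2 * b\<^sup>2) / D + 8 * p * q / D * (a * b)" if "D > 0" for D p q a b :: real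
    using that by (simp add: field_simps power2_eq_square)
  show ?thesis
    unfolding nd overlap_weight_def power2_abs power_mult_distrib[of "wavelength _ _"] power2_minus
      wavelength_square of_int_add of_int_1
    by (rule expand[OF D])
qed

text \<open>On either half each squared sine integrates to 1/4, so the square terms sum to exactly
  1; the halves differ only through the sign of the cross term.\<close>

lemma neumann_halves:
  assumes n: "0 < n"
  shows "(LINT x|lebesgue_on {0..1/2}.
      \<bar>wavelength (n + 1) n * normal_deriv (\<lambda>p. 2 * tri_mode (n + 1) n p) (x, 0)\<bar>\<^sup>2) =
      1 + overlap_weight n * half_overlap n" (is "?A")
    and "(LINT x|lebesgue_on {1/2..1}.
      \<bar>wavelength (n + 1) n * normal_deriv (\<lambda>p. 2 * tri_mode (n + 1) n p) (x, 0)\<bar>\<^sup>2) =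
      1 - overlap_weight n * half_overlap n" (is "?B")
proof -
  let ?d = "\<lambda>x. \<bar>wavelength (n + 1) n * normal_deriv (\<lambda>p. 2 * tri_mode (n + 1) n p) (x, 0)\<bar>\<^sup>2"
  let ?D = "(of_int n + 1)\<^sup>2 + (of_int n)\<^sup>2 :: real"
  let ?f = "\<lambda>x. (4 * (of_int n)\<^sup>2 * (sin_pi (n + 1) x)\<^sup>2 + 4 * (of_int n + 1)\<^sup>2 * (sin_pi n x)\<^sup>2)
      / ?D + overlap_weight n * (sin_pi (n + 1) x * sin_pi n x)"
  have D: "?D > 0" using assms by (simp add: sum_power2_gt_zero_iff)
  have *: "(LINT x|lebesgue_on {a..b}. ?d x) = 1 + overlap_weight n * s"
    if ab: "0 \<le> a" "b \<le> 1"
      and sq: "\<And>k. 0 < k \<Longrightarrow> ((\<lambda>x. (sin_pi k x)\<^sup>2) has_integral 1 / 4) {a..b}"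
      and pr: "((\<lambda>x. sin_pi (n + 1) x * sin_pi n x) has_integral s) {a..b}" for a b s
  proof -
    have "(?f has_integral (4 * (of_int n)\<^sup>2 * (1 / 4) + 4 * (of_int n + 1)\<^sup>2 * (1 / 4)) / ?D
        + overlap_weight n * s) {a..b}"
      using n by (intro has_integral_add has_integral_divide has_integral_mult_right sq pr) simp_all
    moreover have "(4 * (of_int n)\<^sup>2 * (1 / 4) + 4 * (of_int n + 1)\<^sup>2 * (1 / 4)) / ?D = 1"
      using D by simp
    ultimately have "(?f has_integral 1 + overlap_weight n * s) {a..b}" by (simp only:)
    moreover have "integrable (lebesgue_on {a..b}) ?f"
      by (intro continuous_imp_integrable_real continuous_intros) (use D in auto)
    ultimately have "(LINT x|lebesgue_on {a..b}. ?f x) = 1 + overlap_weight n * s"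
      by (simp add: lebesgue_integral_eq_integral integral_unique)
    moreover have "(LINT x|lebesgue_on {a..b}. ?d x) = (LINT x|lebesgue_on {a..b}. ?f x)"
      by (rule Bochner_Integration.integral_cong[OF refl], rule neumann_density[OF n]) (use ab in auto)
    ultimately show ?thesis by simp
  qed
  show ?A
    by (rule *) (simp_all add: has_integral_sin_pi_square_half has_integral_sin_pi_consecutive_half n)
  show ?B
  proof -
    have "(LINT x|lebesgue_on {1/2..1}. ?d x) = 1 + overlap_weight n * - half_overlap n"
      by (rule *) (simp_all add: has_integral_sin_pi_square_half has_integral_sin_pi_consecutive_half n)
    then show ?thesis by simp
  qed
qed

text \<open>The weight tends to 4 and the overlap to 1/(2\<pi>), its second term being at most 1/(2N
  + 1) before the division by 2\<pi>.\<close>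

lemma overlap_tendsto: "(\<lambda>N. overlap_weight (int N) * half_overlap (int N)) \<longlonglongrightarrow> 2 / pi"
proof -
  have "(\<lambda>N. overlap_weight (int N)) \<longlonglongrightarrow> 4"
    unfolding overlap_weight_def of_int_of_nat_eq by real_asymp
  moreover have "(\<lambda>N. half_overlap (int N)) \<longlonglongrightarrow> (1 - 0) / (2 * pi)"
    unfolding half_overlap_def
  proof (intro tendsto_intros)
    have lim: "(\<lambda>N. 1 / (2 * real N + 1)) \<longlonglongrightarrow> 0" by real_asymp
    have bound: "norm (sin_pi (2 * int N + 1) (1 / 2) / of_int (2 * int N + 1)) \<le> 1 / (2 * real N + 1)" for N
    proof -
      have "\<bar>sin_pi (2 * int N + 1) (1 / 2)\<bar> \<le> 1" unfolding sin_pi_def by (rule abs_sin_le_one)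
      then have "\<bar>sin_pi (2 * int N + 1) (1 / 2)\<bar> / (2 * real N + 1) \<le> 1 / (2 * real N + 1)"
        by (rule divide_right_mono) simp
      then show ?thesis by (simp add: abs_divide)
    qed
    show "(\<lambda>N. sin_pi (2 * int N + 1) (1 / 2) / of_int (2 * int N + 1)) \<longlonglongrightarrow> 0"
      by (rule Lim_null_comparison[OF always_eventually[OF allI[OF bound]] lim])
  qed simp
  ultimately have "(\<lambda>N. overlap_weight (int N) * half_overlap (int N)) \<longlonglongrightarrow> 4 * ((1 - 0) / (2 * pi))"
    by (rule tendsto_mult)
  then show ?thesis by simp
qed

lemma wavelength_tendsto: "(\<lambda>N. wavelength (int N + 1) (int N)) \<longlonglongrightarrow> 0"
  unfolding wavelength_def of_int_add of_int_of_nat_eq of_int_1 by real_asymp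

section \<open>The enumerated basis and its subsequence of consecutive pairs\<close>

lemma orthonormal_basis_tri_basis:
  assumes e: "bij_betw e UNIV mode_pairs"
  shows "orthonormal_basis_L2 T (tri_basis e)"
proof (rule orthonormal_basis_L2I)
  show "tri_basis e i \<in> L2 T" for i
    unfolding tri_basis_def by (intro continuous_imp_L2_T continuous_intros continuous_on_tri_mode)
  show "L2_inner T (tri_basis e i) (tri_basis e j) = (if i = j then 1 else 0)" for i j
  proof -
    have "e i \<in> mode_pairs" "e j \<in> mode_pairs" using e by (auto simp: bij_betw_def)
    then have pairs: "0 < snd (e i)" "snd (e i) < fst (e i)" "0 < snd (e j)" "snd (e j) < fst (e j)"
      by (simp_all add: mode_pairs_def case_prod_beta)
    have "L2_inner T (tri_basis e i) (tri_basis e j) = (LINT p|lebesgue_on T.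
        4 * (tri_mode (fst (e i)) (snd (e i)) p * tri_mode (fst (e j)) (snd (e j)) p))"
      unfolding L2_inner_def tri_basis_def by (rule Bochner_Integration.integral_cong) simp_all
    also have "\<dots> = (if e i = e j then 1 else 0)"
      using tri_mode_orthogonal[OF pairs] by (simp add: prod_eq_iff)
    finally have "L2_inner T (tri_basis e i) (tri_basis e j) = (if e i = e j then 1 else 0)" .
    moreover have "e i = e j \<longleftrightarrow> i = j" using e by (auto simp: bij_betw_def inj_eq)
    ultimately show ?thesis by simp
  qed
qed (rule tri_basis_dense[OF e])

text \<open>The enumeration \<open>e\<close> is arbitrary, so the positions of the pairs (n + 1, n)
  are unknown. They form an infinite set \<open>S\<close>, and listing it in increasing order gives
  a strictly monotone \<open>r\<close>.\<close>

lemma obtain_consecutive_subsequence: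
  assumes e: "bij_betw e UNIV mode_pairs"
  obtains r N :: "nat \<Rightarrow> nat" where "strict_mono r" "filterlim N at_top sequentially"
    "\<And>k. e (r k) = (int (N k) + 1, int (N k))" "\<And>k. 0 < N k"
proof -
  define S where "S = {i. fst (e i) = snd (e i) + 1}"
  have inj: "inj e" and range: "range e = mode_pairs" using e by (auto simp: bij_betw_def)
  have "infinite S"
  proof
    assume "finite S"
    \<comment> \<open>The offsets keep the smaller index positive at \<open>j = 0\<close>.\<close>
    have "(\<lambda>j. (int j + 2, int j + 1)) ` UNIV \<subseteq> e ` S"
    proof
      fix q assume "q \<in> (\<lambda>j. (int j + 2, int j + 1)) ` UNIV"
      then obtain j where q: "q = (int j + 2, int j + 1)" by blast
      then have "q \<in> range e" unfolding range by (simp add: mode_pairs_def)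
      then obtain i where i: "q = e i" by blast
      then have "e i = (int j + 2, int j + 1)" using q by simp
      then have "i \<in> S" by (simp add: S_def)
      then show "q \<in> e ` S" using i by blast
    qed
    then have "finite (range (\<lambda>j. (int j + 2, int j + 1)))"
      using \<open>finite S\<close> finite_surj by blast
    moreover have "inj (\<lambda>j. (int j + 2, int j + 1))" by (auto simp: inj_on_def)
    ultimately show False by (simp add: finite_image_iff)
  qed
  define r where "r = enumerate S"
  define N where "N = (\<lambda>k. nat (snd (e (r k))))"
  have r: "strict_mono r" unfolding r_def using \<open>infinite S\<close> by (rule strict_mono_enumerate)
  have rS: "r k \<in> S" for k unfolding r_def using \<open>infinite S\<close> by (rule enumerate_in_set)
  have pos: "0 < snd (e (r k))" for k
    using range by (metis (mono_tags, lifting) case_prod_beta mem_Collect_eq mode_pairs_def rangeI)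
  have eN: "e (r k) = (int (N k) + 1, int (N k))" for k
    using rS[of k] pos[of k] by (simp add: S_def N_def prod_eq_iff)
  have "inj N"
  proof (rule injI)
    fix k l assume "N k = N l"
    then have "e (r k) = e (r l)" by (simp add: eN)
    then show "k = l" using inj r by (metis injD strict_mono_eq)
  qed
  \<comment> \<open>\<open>N\<close> may fail to be monotone, but it is injective, so only finitely
    many \<open>k\<close> have \<open>N k\<close> below a given bound.\<close>
  have "filterlim N at_top sequentially"
    unfolding filterlim_at_top
  proof
    fix Z
    have "{k. \<not> Z \<le> N k} = N -` {..<Z}" by auto
    then have "finite {k. \<not> Z \<le> N k}" using finite_vimageI[OF _ \<open>inj N\<close>] by simp
    then show "\<forall>\<^sub>F k in sequentially. Z \<le> N k"
      by (simp add: cofinite_eq_sequentially[symmetric] eventually_cofinite)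
  qed
  moreover have "0 < N k" for k using pos[of k] by (simp add: N_def)
  ultimately show ?thesis using that r eN by blast
qed

theorem theorem1:
  "\<exists>(u :: nat \<Rightarrow> real \<times> real \<Rightarrow> real) (h :: nat \<Rightarrow> real).
     orthonormal_basis_L2 T u \<and>
     (\<forall>n. dirichlet_eigenfunction (h n) (u n)) \<and>
     (\<forall>n. (L2_norm T (\<lambda>p. h n * dx (u n) p))\<^sup>2 = 1 / 2 \<and>
          (L2_norm T (\<lambda>p. h n * dy (u n) p))\<^sup>2 = 1 / 2) \<and>
     (\<exists>r :: nat \<Rightarrow> nat. strict_mono r \<and> (\<lambda>k. h (r k)) \<longlonglongrightarrow> 0 \<and>
        liminf (\<lambda>k. ereal (LINT x|lebesgue_on {0..1/2}. \<bar>h (r k) * normal_deriv (u (r k)) (x, 0)\<bar>\<^sup>2))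
        > limsup (\<lambda>k. ereal (LINT x|lebesgue_on {1/2..1}. \<bar>h (r k) * normal_deriv (u (r k)) (x, 0)\<bar>\<^sup>2)))"
proof -
  have "infinite mode_pairs"
  proof
    assume "finite mode_pairs"
    then have "finite ((\<lambda>j. (int j + 2, 1 :: int)) ` UNIV)"
      by (rule finite_subset[rotated]) (auto simp: mode_pairs_def)
    moreover have "inj (\<lambda>j. (int j + 2, 1 :: int))" by (auto simp: inj_on_def)
    ultimately show False by (simp add: finite_image_iff)
  qed
  then have e: "bij_betw (from_nat_into mode_pairs) UNIV mode_pairs"
    by (intro bij_betw_from_nat_into) simp_all
  define e where "e = from_nat_into mode_pairs"
  note e = e[folded e_def]
  define u where "u = tri_basis e"
  define h where "h i = wavelength (fst (e i)) (snd (e i))" for i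
  have u: "u i = (\<lambda>p. 2 * tri_mode (fst (e i)) (snd (e i)) p)" for i
    by (simp add: u_def tri_basis_def fun_eq_iff)
  have "e i \<in> mode_pairs" for i using e by (auto simp: bij_betw_def)
  then have pair: "0 < snd (e i)" "snd (e i) < fst (e i)" for i
    by (simp_all add: mode_pairs_def case_prod_beta)
  obtain r N where r: "strict_mono r" and N: "filterlim N at_top sequentially"
    and eN: "\<And>k. e (r k) = (int (N k) + 1, int (N k))" and N0: "\<And>k. 0 < N k"
    using obtain_consecutive_subsequence[OF e] by metis
  let ?c = "\<lambda>k. overlap_weight (int (N k)) * half_overlap (int (N k))"
  have c: "?c \<longlonglongrightarrow> 2 / pi" by (rule filterlim_compose[OF overlap_tendsto N])
  have A: "(LINT x|lebesgue_on {0..1/2}. \<bar>h (r k) * normal_deriv (u (r k)) (x, 0)\<bar>\<^sup>2) = 1 + ?c k"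
    and B: "(LINT x|lebesgue_on {1/2..1}. \<bar>h (r k) * normal_deriv (u (r k)) (x, 0)\<bar>\<^sup>2) = 1 - ?c k" for k
    unfolding h_def u eN using neumann_halves[of "int (N k)"] N0[of k] by simp_all
  \<comment> \<open>Both sequences of Neumann masses converge, so the lower and upper limits are the
    limits 1 + 2/\<pi> and 1 - 2/\<pi>.\<close>
  have "liminf (\<lambda>k. ereal (1 + ?c k)) = ereal (1 + 2 / pi)"
    by (intro lim_imp_Liminf sequentially_bot tendsto_intros c)
  moreover have "limsup (\<lambda>k. ereal (1 - ?c k)) = ereal (1 - 2 / pi)"
    by (intro lim_imp_Limsup sequentially_bot tendsto_intros c)
  moreover have "ereal (1 - 2 / pi) < ereal (1 + 2 / pi)" by simp
  moreover have "(\<lambda>k. h (r k)) \<longlonglongrightarrow> 0"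
    unfolding h_def eN fst_conv snd_conv by (rule filterlim_compose[OF wavelength_tendsto N])
  ultimately have "\<exists>r :: nat \<Rightarrow> nat. strict_mono r \<and> (\<lambda>k. h (r k)) \<longlonglongrightarrow> 0 \<and>
        liminf (\<lambda>k. ereal (LINT x|lebesgue_on {0..1/2}. \<bar>h (r k) * normal_deriv (u (r k)) (x, 0)\<bar>\<^sup>2))
        > limsup (\<lambda>k. ereal (LINT x|lebesgue_on {1/2..1}. \<bar>h (r k) * normal_deriv (u (r k)) (x, 0)\<bar>\<^sup>2))"
    using r by (intro exI[of _ r] conjI) (simp_all only: A B)
  moreover have "orthonormal_basis_L2 T u"
    unfolding u_def by (rule orthonormal_basis_tri_basis[OF e])
  moreover have "dirichlet_eigenfunction (h i) (u i)" for i
    unfolding h_def u by (rule dirichlet_eigenfunction_mode[OF pair])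
  moreover have "(L2_norm T (\<lambda>p. h i * dx (u i) p))\<^sup>2 = 1 / 2"
    "(L2_norm T (\<lambda>p. h i * dy (u i) p))\<^sup>2 = 1 / 2" for i
    unfolding h_def u by (rule L2_norm_gradient_mode[OF pair])+
  ultimately show ?thesis by (intro exI[of _ u] exI[of _ h]) blast
qed

end
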